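(* For every $k\ge 2$, the line query $$L_k = S_1(x_0,x_1), S_2(x_1,x_2),\dots,S_k(x_{k-1},x_k),$$ on input in which all relations have the same size $M$ in bits, can be computed by an MPC algorithm with $p$ servers in at most $\lfloor k/2\rfloor$ rounds with load $\tilde{O}\big(M/p^{1/\lceil (k+1)/2\rceil}\big)$.
   Context: The query asks for all tuples $(x_0,\dots,x_k)$ satisfying all the binary relations (natural join of $k$ distinct relations). All relations have $m$ tuples over a domain $[n]$ and size $M=2m\log n$ bits. MPC model. There are $p$ servers connected by a complete network of private channels. Computation proceeds in synchronous rounds, each consisting of a communication phase (servers exchange data) and a computation phase (unrestricted local computation). The input is initially partitioned evenly among the $p$ servers. At the end, the union of the outputs of the servers must be the full set of answers to the query. The load is the maximum number of bits received by any server during any round. Conventions. $k$ is fixed (constants may depend on it). $\tilde O$ hides factors polylogarithmic in $p$. Algorithms may use randomness (random hash functions), and the load bound holds with high probability (probability tending to $1$ as $p\to\infty$, uniformly over inputs). Data statistics, namely relation sizes and information about heavy hitters (values, or tuples of values, of high frequency in a relation, with their frequencies), are available to the servers. Relation sizes are large compared with $p$ ($m\ge p^{c}$ for a suitable constant $c$ depending only on the query). There is no other assumption on the data distribution. *)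

theory Defs
  imports "HOL-Probability.Probability" "HOL-Library.Landau_Symbols"
begin

section \<open>Binary relations and the line query\<close>

text \<open>An instance is a family \<open>S\<close> of binary relations; only \<open>S 1, \<dots>, S k\<close> are meaningful.
  The domain \<open>[n]\<close> is \<open>{1..n}\<close>.\<close>

type_synonym relations = "nat \<Rightarrow> (nat \<times> nat) set"

definition line_instance :: "nat \<Rightarrow> nat \<Rightarrow> nat \<Rightarrow> relations \<Rightarrow> bool" where
  "line_instance k n m S \<longleftrightarrow> (\<forall>j\<in>{1..k}. S j \<subseteq> {1..n} \<times> {1..n} \<and> card (S j) = m)"

definition line_query :: "nat \<Rightarrow> relations \<Rightarrow> nat list set" where
  "line_query k S = {xs. length xs = k + 1 \<and> (\<forall>j\<in>{1..k}. (xs ! (j - 1), xs ! j) \<in> S j)}"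

definition size_in_bits :: "nat \<Rightarrow> nat \<Rightarrow> real" where
  "size_in_bits n m = 2 * real m * log 2 (real n)"

section \<open>Data statistics\<close>

datatype column = First | Second

fun column_of :: "column \<Rightarrow> nat \<times> nat \<Rightarrow> nat" where
  "column_of First (a, b) = a"
| "column_of Second (a, b) = b"

definition frequency :: "(nat \<times> nat) set \<Rightarrow> column \<Rightarrow> nat \<Rightarrow> nat" where
  "frequency R col a = card {e \<in> R. column_of col e = a}"

record statistics =
  rel_size :: "nat \<Rightarrow> nat"
  heavy_hitters :: "nat \<Rightarrow> column \<Rightarrow> nat \<Rightarrow> nat option"

text \<open>A value is a heavy hitter of a column of a relation with \<open>m\<close> tuples if it occurs there more
  than \<open>m / p\<close> times, so every column has fewer than \<open>p\<close> heavy hitters.  Heavy pairs of values need no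
  entry: a pair has frequency at most 1 in a binary relation, hence is never heavy if \<open>m \<ge> p\<close>.\<close>

definition statistics_of :: "nat \<Rightarrow> nat \<Rightarrow> relations \<Rightarrow> statistics" where
  "statistics_of p k S =
    \<lparr> rel_size = (\<lambda>j. if j \<in> {1..k} then card (S j) else 0),
      heavy_hitters = (\<lambda>j col a.
        if j \<in> {1..k} \<and> real (frequency (S j) col a) > real (card (S j)) / real p
        then Some (frequency (S j) col a) else None) \<rparr>"

section \<open>The MPC model\<close>

text \<open>Servers are \<open>0, \<dots>, p - 1\<close>.  A placement \<open>owner\<close> maps tuple \<open>e\<close> of \<open>S j\<close> to the one server
  that initially holds it.\<close>

definition fragment :: "nat \<Rightarrow> relations \<Rightarrow> (nat \<Rightarrow> nat \<times> nat \<Rightarrow> nat) \<Rightarrow> nat \<Rightarrow> relations" where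
  "fragment k S owner s = (\<lambda>j. if j \<in> {1..k} then {e \<in> S j. owner j e = s} else {})"

text \<open>The bound \<open>k * \<lceil>m / p\<rceil>\<close> on the number of tuples per server admits both the placements that
  split every single relation evenly and those that split only the whole input evenly.\<close>

definition evenly_partitioned ::
    "nat \<Rightarrow> nat \<Rightarrow> nat \<Rightarrow> relations \<Rightarrow> (nat \<Rightarrow> nat \<times> nat \<Rightarrow> nat) \<Rightarrow> bool" where
  "evenly_partitioned p k m S owner \<longleftrightarrow>
    (\<forall>j\<in>{1..k}. \<forall>e\<in>S j. owner j e < p) \<and>
    (\<forall>s<p. int (\<Sum>j=1..k. card (fragment k S owner s j)) \<le> int k * \<lceil>real m / real p\<rceil>)"

text \<open>Since local computation is unrestricted, the state of a server is everything it has seen so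
  far: its fragment of the input, the statistics, the random seed, and for each past round the
  message received from every server.  The seed is shared by all servers, as is needed for agreeing on
  random hash functions.\<close>

record view =
  local_input :: relations
  stats :: statistics
  seed :: nat
  inboxes :: "(nat \<Rightarrow> bool list) list"

text \<open>\<open>send A s t v\<close> is the bit string that server \<open>s\<close> with view \<open>v\<close> sends to server \<open>t\<close> in the
  current round; the number of the round is visible as the length of \<open>inboxes v\<close>.\<close>

record mpc_algorithm =
  rounds :: nat
  seed_distribution :: "nat pmf"
  send :: "nat \<Rightarrow> nat \<Rightarrow> view \<Rightarrow> bool list"
  answers :: "nat \<Rightarrow> view \<Rightarrow> nat list set"

definition initial_view ::
    "nat \<Rightarrow> nat \<Rightarrow> relations \<Rightarrow> (nat \<Rightarrow> nat \<times> nat \<Rightarrow> nat) \<Rightarrow> nat \<Rightarrow> nat \<Rightarrow> view" where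
  "initial_view p k S owner \<omega> s =
    \<lparr> local_input = fragment k S owner s, stats = statistics_of p k S, seed = \<omega>, inboxes = [] \<rparr>"

text \<open>\<open>view_after A p V r s\<close> is the view of server \<open>s\<close> after \<open>r\<close> rounds, starting from the
  views \<open>V\<close>.\<close>

primrec view_after :: "mpc_algorithm \<Rightarrow> nat \<Rightarrow> (nat \<Rightarrow> view) \<Rightarrow> nat \<Rightarrow> nat \<Rightarrow> view" where
  "view_after A p V 0 = V"
| "view_after A p V (Suc r) = (\<lambda>s. (view_after A p V r s)
    \<lparr> inboxes := inboxes (view_after A p V r s) @
        [\<lambda>t. if t < p then send A t s (view_after A p V r t) else []] \<rparr>)"

definition bits_received :: "mpc_algorithm \<Rightarrow> nat \<Rightarrow> (nat \<Rightarrow> view) \<Rightarrow> nat \<Rightarrow> nat \<Rightarrow> nat" where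
  "bits_received A p V r s = (\<Sum>t<p. length (send A t s (view_after A p V r t)))"

text \<open>The 0 only matters for an algorithm without rounds.\<close>

definition mpc_load :: "mpc_algorithm \<Rightarrow> nat \<Rightarrow> (nat \<Rightarrow> view) \<Rightarrow> nat" where
  "mpc_load A p V = Max (insert 0 {bits_received A p V r s | r s. r < rounds A \<and> s < p})"

definition mpc_output :: "mpc_algorithm \<Rightarrow> nat \<Rightarrow> (nat \<Rightarrow> view) \<Rightarrow> nat list set" where
  "mpc_output A p V = (\<Union>s<p. answers A s (view_after A p V (rounds A) s))"

definition polylog :: "(nat \<Rightarrow> real) \<Rightarrow> bool" where
  "polylog f \<longleftrightarrow> (\<exists>d::nat. f \<in> O(\<lambda>p. ln (real p) ^ d))"

end

theory Submission
  imports Defs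
begin

text \<open>Two rounds suffice for every \<open>k\<close>, and one if \<open>k \<le> 3\<close>.  Put \<open>d = \<lceil>(k + 1) / 2\<rceil>\<close>,
  \<open>q = \<lfloor>p powr (1 / d)\<rfloor>\<close> and arrange \<open>q ^ d\<close> servers in a \<open>d\<close>-dimensional grid.  The \<open>d\<close> relations
  \<open>S\<^sub>1, S\<^sub>3, S\<^sub>5, \<dots>\<close> (and \<open>S\<^sub>k\<close>, if \<open>k\<close> is even) cover all variables, and each of them is split into
  \<open>q\<close> groups of about \<open>m / q\<close> tuples, one for each value of its coordinate.  A tuple is
  grouped by a random hash of one of its columns, where a value of frequency \<open>D > m / q\<close> owns an arc of
  \<open>\<lceil>D q / m\<rceil>\<close> cyclically consecutive groups and its tuples are dealt out evenly to these.

  A tuple \<open>(y, z)\<close> of a connecting relation \<open>S\<^bsub>2i\<^esub>\<close> is needed at coordinates \<open>j, l\<close> if \<open>y\<close> occurs in group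
  \<open>j\<close> of \<open>S\<^bsub>2i-1\<^esub>\<close> and \<open>l\<close> lies in the arc of \<open>z\<close>.  In the first round every coordinate
  \<open>j\<close> gets all of \<open>S\<^bsub>2i\<^esub>\<close>, distributed over the \<open>q ^ (d - 1)\<close> servers with this coordinate, which suffices to
  compute the semijoins; the second round sends the remaining tuples to their destinations.  The
  relation \<open>S\<^sub>2\<close> needs no semijoin because \<open>S\<^sub>1\<close> can be grouped by its second column.

  All loads are sums of weights over the values whose random arc contains a given group.  The weights
  are \<open>O(m / q)\<close> up to logarithms and have total at most \<open>m\<close>, so an exponential moment bounds the
  sums by \<open>O(m / q)\<close> times another logarithm.\<close>

section \<open>Random arcs\<close>

definition cyclic_arc :: "nat \<Rightarrow> nat \<Rightarrow> nat \<Rightarrow> nat set" where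
  "cyclic_arc q a r = (\<lambda>x. (a + x) mod q) ` {..<r}"

text \<open>The offset \<open>x < r\<close> at which the arc hits \<open>l\<close> determines its
  start as \<open>l - x\<close> modulo \<open>q\<close>. The proof computes this in
  \<open>int\<close> to avoid truncated subtraction.\<close>

lemma card_arcs_containing_le:
  assumes "q \<ge> 1" "l < q"
  shows "card {a \<in> {..<q}. l \<in> cyclic_arc q a r} \<le> r"
proof -
  have "a \<in> (\<lambda>x. nat ((int l - int x) mod int q)) ` {..<r}"
    if "a \<in> {a \<in> {..<q}. l \<in> cyclic_arc q a r}" for a
  proof -
    from that obtain x where x: "x < r" "l = (a + x) mod q" by (auto simp: cyclic_arc_def)
    have "a < q" using that by simp
    then have "(int l - int x) mod int q = int a"
      unfolding x(2) by (simp add: zmod_int mod_diff_left_eq)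
    then show ?thesis using x by (intro image_eqI[of _ _ x]) auto
  qed
  then have "{a \<in> {..<q}. l \<in> cyclic_arc q a r} \<subseteq> (\<lambda>x. nat ((int l - int x) mod int q)) ` {..<r}"
    by (rule subsetI)
  then have "card {a \<in> {..<q}. l \<in> cyclic_arc q a r}
      \<le> card ((\<lambda>x. nat ((int l - int x) mod int q)) ` {..<r})"
    by (intro card_mono) auto
  also have "\<dots> \<le> card {..<r}" by (rule card_image_le) simp
  finally show ?thesis by simp
qed

text \<open>The hash values serve as starts of arcs. Full independence is affordable because the
  shared seed does not count as communication.\<close>

definition hash :: "nat \<Rightarrow> nat \<Rightarrow> (nat \<Rightarrow> nat) pmf" where
  "hash n q = Pi_pmf {1..n} 0 (\<lambda>_. pmf_of_set {..<q})"

lemma finite_set_pmf_hash: "q \<ge> 1 \<Longrightarrow> finite (set_pmf (hash n q))"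
  unfolding hash_def
  by (subst set_Pi_pmf) (auto simp: set_pmf_of_set lessThan_empty_iff intro!: finite_PiE_dflt)

lemma exp_minus_one_le:
  fixes x :: real
  assumes "0 \<le> x" "x \<le> 1"
  shows "exp x \<le> 1 + 2 * x"
proof -
  have "exp x \<le> 1 + x + x\<^sup>2" using assms by (rule exp_bound)
  moreover have "x\<^sup>2 \<le> x" using assms by (simp add: power2_eq_square mult_left_le_one_le)
  ultimately show ?thesis by simp
qed

text \<open>Exponential moment and Markov.  The arcs of length at most 1 contribute at most \<open>B\<close> to the mean
  of the sum, and the longer ones at most \<open>2 * B\<close>.\<close>

lemma arc_weight_tail:
  fixes w :: "nat \<Rightarrow> real" and r :: "nat \<Rightarrow> nat"
  assumes q: "q \<ge> 1" "l < q"
    and w: "\<And>z. z \<in> {1..n} \<Longrightarrow> 0 \<le> w z" "\<And>z. z \<in> {1..n} \<Longrightarrow> w z \<le> B"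
    and total: "(\<Sum>z=1..n. w z) \<le> B * q"
    and long: "(\<Sum>z | z \<in> {1..n} \<and> r z \<ge> 2. r z) \<le> 2 * q"
    and B: "B > 0"
  shows "measure_pmf.prob (hash n q)
           {g. (\<Sum>z=1..n. w z * indicator (cyclic_arc q (g z) (r z)) l) > B * s} \<le> exp (6 - s)"
proof -
  define f where "f z a = exp (w z / B * indicator (cyclic_arc q a (r z)) l)" for z a
  define X where "X g = (\<Sum>z=1..n. w z * indicator (cyclic_arc q (g z) (r z)) l)" for g
  \<comment> \<open>The arc of \<open>z\<close> contains \<open>l\<close> with probability at most
    \<open>r z / q\<close>, and on \<open>[0, 1]\<close> the exponential lies below the line
    \<open>1 + 2 * x\<close>.\<close>
  have mean: "measure_pmf.expectation (pmf_of_set {..<q}) (f z) \<le> exp (2 * w z * r z / (B * q))"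
    if z: "z \<in> {1..n}" for z
  proof -
    have f_le: "f z a \<le> 1 + 2 * (w z / B) * indicator (cyclic_arc q a (r z)) l" for a
      using exp_minus_one_le[of "w z / B"] w[OF z] B by (auto simp: f_def indicator_def)
    have "measure_pmf.expectation (pmf_of_set {..<q}) (f z) = (\<Sum>a<q. f z a) / q"
      using q by (subst integral_pmf_of_set) auto
    also have "\<dots> \<le> (\<Sum>a<q. 1 + 2 * (w z / B) * indicator (cyclic_arc q a (r z)) l) / q"
      using f_le by (intro divide_right_mono sum_mono) auto
    also have "(\<Sum>a<q. 1 + 2 * (w z / B) * indicator (cyclic_arc q a (r z)) l)
        = q + 2 * (w z / B) * card {a \<in> {..<q}. l \<in> cyclic_arc q a (r z)}"
      by (simp add: sum.distrib indicator_def Int_def flip: sum_distrib_left sum_divide_distrib)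
    also have "\<dots> \<le> q + 2 * (w z / B) * r z"
      using card_arcs_containing_le[OF q, of "r z"] w[OF z] B
      by (intro add_left_mono mult_left_mono) auto
    also have "(q + 2 * (w z / B) * r z) / q = 1 + 2 * w z * r z / (B * q)"
      using q B by (simp add: field_simps)
    also have "\<dots> \<le> exp (2 * w z * r z / (B * q))" by (rule exp_ge_add_one_self)
    finally show ?thesis using q by (simp add: divide_right_mono)
  qed
  have "(\<Sum>z=1..n. w z * r z) \<le> (\<Sum>z=1..n. w z + (if r z \<ge> 2 then B * r z else 0))"
  proof (rule sum_mono)
    fix z assume z: "z \<in> {1..n}"
    show "w z * r z \<le> w z + (if r z \<ge> 2 then B * r z else 0)"
    proof (cases "r z \<ge> 2")
      case True
      then show ?thesis using w[OF z] by (simp add: mult_right_mono add_increasing)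
    next
      case False
      then have "r z = 0 \<or> r z = 1" by auto
      then show ?thesis using w[OF z] by auto
    qed
  qed
  also have "\<dots> = (\<Sum>z=1..n. w z) + B * (\<Sum>z | z \<in> {1..n} \<and> r z \<ge> 2. r z)"
    by (simp add: sum.distrib sum.If_cases Int_def sum_distrib_left)
  also have "\<dots> \<le> B * q + B * (2 * q)"
    using total long B by (intro add_mono mult_left_mono) (simp_all flip: of_nat_sum)
  finally have sum_le: "(\<Sum>z=1..n. w z * r z) \<le> 3 * (B * q)" by simp
  have fin: "finite (set_pmf (hash n q))" using q finite_set_pmf_hash by blast
  have exp_X: "exp (X g / B) = (\<Prod>z=1..n. f z (g z))" for g
    unfolding f_def
    by (subst exp_sum [symmetric]) (simp_all only: X_def sum_divide_distrib times_divide_eq_left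
        finite_atLeastAtMost)
  have "measure_pmf.expectation (hash n q) (\<lambda>g. exp (X g / B))
      = measure_pmf.expectation (hash n q) (\<lambda>g. \<Prod>z=1..n. f z (g z))"
    by (simp only: exp_X)
  also have "\<dots> = (\<Prod>z=1..n. measure_pmf.expectation (pmf_of_set {..<q}) (f z))"
    unfolding hash_def
  proof (rule expectation_prod_Pi_pmf)
    show "integrable (measure_pmf (pmf_of_set {..<q})) (f z)" for z
      using q by (intro integrable_measure_pmf_finite) (auto simp: lessThan_empty_iff)
    show "f z a \<ge> 0" for z a
      by (simp add: f_def)
  qed simp
  also have "\<dots> \<le> (\<Prod>z=1..n. exp (2 * w z * r z / (B * q)))"
    using mean by (intro prod_mono conjI Bochner_Integration.integral_nonneg) (auto simp: f_def)
  also have "\<dots> = exp (2 * (\<Sum>z=1..n. w z * r z) / (B * q))"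
    by (subst exp_sum [symmetric]) (simp_all only: sum_distrib_left sum_divide_distrib mult.assoc
        finite_atLeastAtMost)
  \<comment> \<open>The 6 is 2 from the linear bound on \<open>exp\<close> times 3 from
    \<open>sum_le\<close>.\<close>
  also have "\<dots> \<le> exp 6"
  proof -
    have "B * q > 0" using B q by simp
    then show ?thesis using sum_le by (simp only: exp_le_cancel_iff pos_divide_le_eq)
  qed
  finally have mgf: "measure_pmf.expectation (hash n q) (\<lambda>g. exp (X g / B)) \<le> exp 6" .
  have "measure_pmf.prob (hash n q) {g. X g > B * s}
      \<le> measure_pmf.prob (hash n q) {g. exp (X g / B) \<ge> exp s}"
    using B by (intro measure_pmf.finite_measure_mono) (auto simp: field_simps)
  also have "\<dots> \<le> measure_pmf.expectation (hash n q) (\<lambda>g. exp (X g / B)) / exp s"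
    using integral_Markov_inequality_measure[OF integrable_measure_pmf_finite[OF fin], of UNIV
        "\<lambda>g. exp (X g / B)" "exp s"]
    by simp
  also have "\<dots> \<le> exp 6 / exp s" using mgf by (intro divide_right_mono) auto
  finally show ?thesis by (simp add: X_def exp_diff)
qed

text \<open>Coordinate \<open>i\<close> is drawn last. By \<open>indep\<close> the first argument of
  \<open>Q\<close> matters only through the other coordinates, so \<open>bound\<close> applies
  conditionally on them. This allows weights that depend on other hash functions.\<close>

lemma prob_Pi_pmf_coordinate_le:
  assumes "finite I" "i \<in> I"
    and indep: "\<And>g x y. Q (g(i := x)) y = Q g y"
    and bound: "\<And>g. measure_pmf.prob (P i) {x. Q g x} \<le> \<epsilon>"
  shows "measure_pmf.prob (Pi_pmf I dflt P) {g. Q g (g i)} \<le> \<epsilon>"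
proof -
  have I: "I = insert i (I - {i})" using assms(2) by auto
  define R where "R = Pi_pmf (I - {i}) dflt P"
  have "Pi_pmf I dflt P = bind_pmf (P i) (\<lambda>x. bind_pmf R (\<lambda>g. return_pmf (g(i := x))))"
    unfolding R_def by (subst I, subst Pi_pmf_insert') (use assms(1) in simp_all)
  also have "\<dots> = bind_pmf R (\<lambda>g. map_pmf (\<lambda>x. g(i := x)) (P i))"
    by (subst bind_commute_pmf) (simp add: map_pmf_def)
  finally have eq: "Pi_pmf I dflt P = \<dots>" .
  have \<epsilon>: "\<epsilon> \<ge> 0" using order_trans[OF measure_nonneg bound[of undefined]] .
  have "emeasure (measure_pmf (Pi_pmf I dflt P)) {g. Q g (g i)}
      = (\<integral>\<^sup>+g. emeasure (measure_pmf (P i)) {x. Q g x} \<partial>measure_pmf R)"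
    by (simp add: eq indep vimage_def)
  also have "\<dots> \<le> (\<integral>\<^sup>+g. ennreal \<epsilon> \<partial>measure_pmf R)"
    using bound by (intro nn_integral_mono) (simp add: measure_pmf.emeasure_eq_measure ennreal_leI)
  also have "\<dots> = ennreal \<epsilon>" by simp
  finally show ?thesis using \<epsilon> by (simp add: measure_pmf.emeasure_eq_measure)
qed

lemma prob_UN_le:
  fixes \<epsilon> :: real
  assumes "finite I" "\<And>i. i \<in> I \<Longrightarrow> measure_pmf.prob M (A i) \<le> \<epsilon>"
  shows "measure_pmf.prob M (\<Union>i\<in>I. A i) \<le> card I * \<epsilon>"
proof -
  have "measure_pmf.prob M (\<Union>i\<in>I. A i) \<le> (\<Sum>i\<in>I. measure_pmf.prob M (A i))"
    using assms(1) by (intro measure_pmf.finite_measure_subadditive_finite) auto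
  also have "\<dots> \<le> card I * \<epsilon>" using assms(2) by (intro sum_bounded_above) auto
  finally show ?thesis .
qed

section \<open>Encoding sets by bit strings\<close>

text \<open>Elements get code words of exactly \<open>w\<close> bits, and a set becomes the
  concatenation along a chosen enumeration. Fixed width makes this decodable, and
  \<open>w > 0\<close> lets the length reveal the cardinality.\<close>

lemma set_encoding_exists:
  fixes U :: "'a set"
  assumes "finite U" "card U \<le> 2 ^ w" "w > 0"
  obtains enc :: "'a set \<Rightarrow> bool list"
  where "inj_on enc (Pow U)" "\<And>X. X \<subseteq> U \<Longrightarrow> length (enc X) = w * card X"
proof -
  let ?C = "{xs::bool list. set xs \<subseteq> UNIV \<and> length xs = w}"
  have "card ?C = 2 ^ w" "finite ?C"
    using card_lists_length_eq[of "UNIV :: bool set" w] finite_lists_length_eq[of "UNIV :: bool set" w]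
    by simp_all
  then obtain c where c: "c ` U \<subseteq> ?C" "inj_on c U"
    using card_le_inj[of U ?C] assms by auto
  define enumerate where "enumerate X = (SOME ys. set ys = X \<and> distinct ys)" for X :: "'a set"
  have en: "set (enumerate X) = X \<and> distinct (enumerate X)" if "X \<subseteq> U" for X
    unfolding enumerate_def
    by (rule someI_ex) (use finite_distinct_list finite_subset[OF that assms(1)] in auto)
  define enc where "enc X = concat (map c (enumerate X))" for X
  have len: "length (enc X) = w * card X" if "X \<subseteq> U" for X
  proof -
    have "length (enc X) = (\<Sum>x\<leftarrow>enumerate X. w)"
      unfolding enc_def length_concat map_map o_def
      using en[OF that] that c(1) by (intro arg_cong[of _ _ sum_list] map_cong) auto
    then show ?thesis
      using en[OF that] by (simp add: sum_list_triv distinct_card[symmetric] mult.commute)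
  qed
  have uniq: "xs = ys"
    if "set xs \<subseteq> U" "set ys \<subseteq> U" "concat (map c xs) = concat (map c ys)"
      "length xs = length ys" for xs ys
    using that(4,1,2,3)
  proof (induction xs ys rule: list_induct2)
    case (Cons x xs y ys)
    have "length (c x) = length (c y)" using Cons.prems c(1) by auto
    then have "c x = c y" "concat (map c xs) = concat (map c ys)" using Cons.prems by auto
    then show ?case using Cons c(2) by (auto dest: inj_onD)
  qed simp
  have "inj_on enc (Pow U)"
  proof (rule inj_onI)
    fix X Y assume XY: "X \<in> Pow U" "Y \<in> Pow U" "enc X = enc Y"
    then have "w * card X = w * card Y" using len by (metis PowD)
    then have "length (enumerate X) = length (enumerate Y)"
      using assms(3) en XY by (metis PowD distinct_card mult_cancel1 not_gr_zero)
    then have "enumerate X = enumerate Y" using uniq XY en by (auto simp: enc_def)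
    then show "X = Y" using en XY by (metis PowD)
  qed
  then show ?thesis using len by (rule that)
qed

section \<open>Counting\<close>

lemma card_residue_class_le:
  fixes r x N :: nat
  assumes "r \<ge> 1"
  shows "card {a. a < N \<and> a mod r = x} \<le> N div r + 1"
proof -
  have "{a. a < N \<and> a mod r = x} \<subseteq> (\<lambda>b. b * r + x) ` {..N div r}"
  proof
    fix a assume a: "a \<in> {a. a < N \<and> a mod r = x}"
    then have "a = (a div r) * r + x" using div_mult_mod_eq[of a r] by auto
    moreover have "a div r \<le> N div r" using a by (simp add: div_le_mono)
    ultimately show "a \<in> (\<lambda>b. b * r + x) ` {..N div r}" by blast
  qed
  then have "card {a. a < N \<and> a mod r = x} \<le> card ((\<lambda>b. b * r + x) ` {..N div r})"
    by (intro card_mono) auto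
  also have "\<dots> \<le> card {..N div r}" by (rule card_image_le) simp
  finally show ?thesis by simp
qed

text \<open>This is dealing in turn: ranks under an injective \<open>f\<close> are distinct numbers
  below \<open>card X\<close>, so every residue receives nearly the same share.\<close>

lemma card_rank_mod_le:
  fixes f :: "'a \<Rightarrow> nat"
  assumes "finite X" "inj_on f X" "r \<ge> 1"
  shows "card {e \<in> X. card {e' \<in> X. f e' < f e} mod r = x} \<le> card X div r + 1"
proof -
  define rk where "rk e = card {e' \<in> X. f e' < f e}" for e
  have less: "rk a < rk b" if "a \<in> X" "b \<in> X" "f a < f b" for a b
    unfolding rk_def using that assms(1) by (intro psubset_card_mono) auto
  have inj: "inj_on rk X"
  proof (rule inj_onI)
    fix a b assume ab: "a \<in> X" "b \<in> X" "rk a = rk b"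
    then have "f a = f b" using less[of a b] less[of b a] by (metis less_irrefl linorder_neqE_nat)
    then show "a = b" using assms(2) ab by (auto dest: inj_onD)
  qed
  have lt: "rk e < card X" if "e \<in> X" for e
    unfolding rk_def using that assms(1) by (intro psubset_card_mono) auto
  have "card {e \<in> X. rk e mod r = x} = card (rk ` {e \<in> X. rk e mod r = x})"
    using inj by (intro card_image[symmetric]) (auto simp: inj_on_def)
  also have "\<dots> \<le> card {a. a < card X \<and> a mod r = x}"
    using lt by (intro card_mono) auto
  also have "\<dots> \<le> card X div r + 1" using assms(3) by (rule card_residue_class_le)
  finally show ?thesis by (simp add: rk_def)
qed

lemma card_fibres:
  assumes "finite A" "finite T" "g ` A \<subseteq> T"
  shows "(\<Sum>y\<in>T. card {x \<in> A. g x = y}) = card A"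
  using sum.group[OF assms, of "\<lambda>_. 1::nat"] by simp

lemma add_mod_left_cancel:
  fixes a x y q :: nat
  assumes "(a + x) mod q = (a + y) mod q" "x < q" "y < q"
  shows "x = y"
  using assms
proof (induction x y rule: linorder_wlog)
  case (le x y)
  then have "q dvd (a + y) - (a + x)" by (metis add_le_cancel_left mod_eq_dvd_iff_nat)
  then have "q dvd y - x" by simp
  then show ?case using le by (metis diff_is_0_eq diff_le_self dvd_imp_le le_antisym
        linorder_not_less not_gr_zero order_le_less_trans)
qed simp

lemma card_tagged_UN_le:
  fixes c :: real
  assumes "finite I" "\<And>i. i \<in> I \<Longrightarrow> card (X i) \<le> c"
  shows "card (\<Union>i\<in>I. {f i} \<times> X i) \<le> card I * c"
proof -
  have "card (\<Union>i\<in>I. {f i} \<times> X i) \<le> (\<Sum>i\<in>I. card ({f i} \<times> X i))"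
    using assms(1) by (rule card_UN_le)
  then have "real (card (\<Union>i\<in>I. {f i} \<times> X i)) \<le> (\<Sum>i\<in>I. real (card ({f i} \<times> X i)))"
    by (simp flip: of_nat_sum)
  also have "\<dots> \<le> card I * c"
    using assms(2) by (intro sum_bounded_above) (simp add: card_cartesian_product)
  finally show ?thesis .
qed

section \<open>The algorithm\<close>

type_synonym items = "(nat \<times> nat \<times> nat) set"

text \<open>Servers \<open>t < q ^ d\<close> form a \<open>d\<close>-dimensional grid of side \<open>q\<close>, and \<open>coords t i\<close> is the
  \<open>i\<close>-th coordinate of \<open>t\<close>.\<close>

locale line_grid =
  fixes k n m p q d w :: nat
    and coords :: "nat \<Rightarrow> nat \<Rightarrow> nat"
    and enc :: "items \<Rightarrow> bool list"
  assumes k: "k \<ge> 2" and d: "d = k div 2 + 1"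
    and q: "q \<ge> 1" "q ^ d \<le> p" and m: "m \<ge> 1"
    and coords: "bij_betw coords {..<q ^ d} ({..<d} \<rightarrow>\<^sub>E {..<q})"
    and enc: "inj_on enc (Pow ({1..k} \<times> {1..n} \<times> {1..n}))"
    and length_enc: "X \<subseteq> {1..k} \<times> {1..n} \<times> {1..n} \<Longrightarrow> length (enc X) = w * card X"
begin

text \<open>Dimension \<open>i\<close> of the grid belongs to the relation \<open>rel_of i\<close>: these are \<open>S\<^sub>1, S\<^sub>3, S\<^sub>5, \<dots>\<close>, and
  also \<open>S\<^sub>k\<close> if \<open>k\<close> is even.\<close>

definition rel_of :: "nat \<Rightarrow> nat" where
  "rel_of i = min (2 * i + 1) k"

text \<open>The key is the variable shared with the connecting relation: \<open>x_1\<close>, shared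
  with \<open>S 2\<close>, for \<open>i = 0\<close>, and \<open>x_(2i)\<close>, shared with
  \<open>S (2 * i)\<close>, for \<open>i > 0\<close> and \<open>2 * i < k\<close>.\<close>

definition col_of :: "nat \<Rightarrow> column" where
  "col_of i = (if i = 0 then Second else First)"

abbreviation key :: "nat \<Rightarrow> nat \<times> nat \<Rightarrow> nat" where
  "key i \<equiv> column_of (col_of i)"

text \<open>The arc is long enough to leave about \<open>m / q\<close> tuples per group. A value
  missing from the statistics occurs at most \<open>m / p\<close> times, hence at most
  \<open>m / q\<close> times, and one group suffices.\<close>

definition span_of :: "statistics \<Rightarrow> nat \<Rightarrow> nat \<Rightarrow> nat" where
  "span_of st i z = (case heavy_hitters st (rel_of i) (col_of i) z of
     None \<Rightarrow> 1 | Some f \<Rightarrow> nat \<lceil>real f * real q / real m\<rceil>)"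

definition targets :: "statistics \<Rightarrow> (nat \<Rightarrow> nat \<Rightarrow> nat) \<Rightarrow> nat \<Rightarrow> nat \<Rightarrow> nat set" where
  "targets st h i z = cyclic_arc q (h i z) (span_of st i z)"

text \<open>\<open>prod_encode\<close> merely fixes an order in which tuples with the same key are
  dealt out.\<close>

definition rank :: "nat \<Rightarrow> (nat \<times> nat) set \<Rightarrow> nat \<times> nat \<Rightarrow> nat" where
  "rank i X e = card {e' \<in> {e' \<in> X. key i e' = key i e}. prod_encode e' < prod_encode e}"

text \<open>Every server deals its tuples with a given key out to the targets of the key in turn.\<close>

definition group_of ::
    "statistics \<Rightarrow> (nat \<Rightarrow> nat \<Rightarrow> nat) \<Rightarrow> nat \<Rightarrow> (nat \<times> nat) set \<Rightarrow> nat \<times> nat \<Rightarrow> nat" where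
  "group_of st h i X e = (h i (key i e) + rank i X e mod span_of st i (key i e)) mod q"

text \<open>In the first round the relations \<open>rel_of i\<close> reach their final destinations. So does \<open>S\<^sub>2\<close>,
  because \<open>S\<^sub>1\<close> is grouped by its second column. Every other connecting relation \<open>S\<^bsub>2i\<^esub>\<close> is spread
  over the servers so that each tuple meets every value of coordinate \<open>i - 1\<close> exactly once.\<close>

definition message1 ::
    "statistics \<Rightarrow> (nat \<Rightarrow> nat \<Rightarrow> nat) \<Rightarrow> relations \<Rightarrow> nat \<Rightarrow> nat \<Rightarrow> items" where
  "message1 st h X s t = (if t < q ^ d then
     {(rel_of i, e) | i e. i < d \<and> e \<in> X (rel_of i) \<and>
        group_of st h i (X (rel_of i)) e = coords t i} \<union>
     {(2, e) | e. 2 < k \<and> e \<in> X 2 \<and> coords t 0 \<in> targets st h 0 (fst e) \<and>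
        coords t 1 \<in> targets st h 1 (snd e)} \<union>
     {(2 * i, e) | i e. 2 \<le> i \<and> 2 * i < k \<and> e \<in> X (2 * i) \<and>
        (\<forall>i'<d. i' \<noteq> i - 1 \<longrightarrow> coords t i' = coords (s mod q ^ d) i')}
   else {})"

text \<open>A group of \<open>S\<^bsub>2i-1\<^esub>\<close> has few tuples, so after the semijoin with it every value in the second
  column of \<open>S\<^bsub>2i\<^esub>\<close> has low frequency, and hashing that column balances the load.\<close>

definition message2 ::
    "statistics \<Rightarrow> (nat \<Rightarrow> nat \<Rightarrow> nat) \<Rightarrow> items \<Rightarrow> nat \<Rightarrow> nat \<Rightarrow> items" where
  "message2 st h D s t = (if s < q ^ d \<and> t < q ^ d then
     {(2 * i, e) | i e. 2 \<le> i \<and> 2 * i < k \<and> (2 * i, e) \<in> D \<and>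
        (\<exists>x. (rel_of (i - 1), x, fst e) \<in> D) \<and>
        coords t (i - 1) = coords s (i - 1) \<and> coords t i \<in> targets st h i (snd e)}
   else {})"

definition items_received :: "view \<Rightarrow> nat \<Rightarrow> items" where
  "items_received v r =
     (\<Union>s<p. inv_into (Pow ({1..k} \<times> {1..n} \<times> {1..n})) enc ((inboxes v ! r) s))"

definition hashes :: "(nat \<Rightarrow> nat \<Rightarrow> nat) pmf" where
  "hashes = Pi_pmf {..<d} (\<lambda>_. 0) (\<lambda>_. hash n q)"

text \<open>Seeds are natural numbers, so hash functions are passed through an enumeration of the
  countable support of \<open>hashes\<close>.\<close>

definition hash_of_seed :: "nat \<Rightarrow> nat \<Rightarrow> nat \<Rightarrow> nat" where
  "hash_of_seed = from_nat_into (set_pmf hashes)"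

text \<open>For \<open>k <= 3\<close> the bound \<open>k div 2\<close> allows a single round, which
  suffices because only \<open>S 2\<close> can be a connecting relation.\<close>

definition algorithm :: mpc_algorithm where
  "algorithm = \<lparr>
     rounds = (if k \<le> 3 then 1 else 2),
     seed_distribution = map_pmf (to_nat_on (set_pmf hashes)) hashes,
     send = (\<lambda>s t v. enc (
       if inboxes v = [] then message1 (stats v) (hash_of_seed (seed v)) (local_input v) s t
       else message2 (stats v) (hash_of_seed (seed v)) (items_received v 0) s t)),
     answers = (\<lambda>s v. {xs. length xs = k + 1 \<and>
       (\<forall>j\<in>{1..k}. (j, xs ! (j - 1), xs ! j) \<in> (\<Union>r<length (inboxes v). items_received v r))}) \<rparr>"

lemma message1_coordinateI:
  assumes "t < q ^ d" "i < d" "e \<in> X (rel_of i)" "group_of st h i (X (rel_of i)) e = coords t i"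
  shows "(rel_of i, e) \<in> message1 st h X s t"
  unfolding message1_def if_P[OF assms(1)] using assms(2-) by blast

lemma message1_secondI:
  assumes "t < q ^ d" "2 < k" "e \<in> X 2" "coords t 0 \<in> targets st h 0 (fst e)"
    "coords t 1 \<in> targets st h 1 (snd e)"
  shows "(2, e) \<in> message1 st h X s t"
  unfolding message1_def if_P[OF assms(1)] using assms(2-) by blast

lemma message1_connectingI:
  assumes "t < q ^ d" "2 \<le> i" "2 * i < k" "e \<in> X (2 * i)"
    "\<And>i'. i' < d \<Longrightarrow> i' \<noteq> i - 1 \<Longrightarrow> coords t i' = coords (s mod q ^ d) i'"
  shows "(2 * i, e) \<in> message1 st h X s t"
  unfolding message1_def if_P[OF assms(1)] using assms(2-) by blast

lemma message1_cases:
  assumes "(j, e) \<in> message1 st h X s t"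
  obtains (coordinate) i where "t < q ^ d" "j = rel_of i" "i < d" "e \<in> X j"
      "group_of st h i (X j) e = coords t i"
    | (second) "t < q ^ d" "j = 2" "2 < k" "e \<in> X j" "coords t 0 \<in> targets st h 0 (fst e)"
      "coords t 1 \<in> targets st h 1 (snd e)"
    | (connecting) i where "t < q ^ d" "j = 2 * i" "2 \<le> i" "2 * i < k" "e \<in> X j"
      "\<And>i'. i' < d \<Longrightarrow> i' \<noteq> i - 1 \<Longrightarrow> coords t i' = coords (s mod q ^ d) i'"
proof -
  have t: "t < q ^ d" using assms by (auto simp: message1_def split: if_splits)
  from assms show ?thesis
    unfolding message1_def if_P[OF t] using t that by blast
qed

lemma message2I:
  assumes "s < q ^ d" "t < q ^ d" "2 \<le> i" "2 * i < k" "(2 * i, e) \<in> D"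
    "(rel_of (i - 1), x, fst e) \<in> D" "coords t (i - 1) = coords s (i - 1)"
    "coords t i \<in> targets st h i (snd e)"
  shows "(2 * i, e) \<in> message2 st h D s t"
  unfolding message2_def if_P[OF conjI[OF assms(1,2)]] using assms(3-) by blast

lemma rel_of_bounds: "rel_of i \<in> {1..k}"
  using k by (auto simp: rel_of_def)

lemma connecting_rel_neq_rel_of: "2 * i < k \<Longrightarrow> rel_of i' \<noteq> 2 * i"
  by (auto simp: rel_of_def min_def) presburger

lemma rel_of_eq_odd:
  assumes "i < d" "2 * j + 1 \<le> k" "rel_of i = 2 * j + 1"
  shows "i = j"
  using assms d by (auto simp: rel_of_def min_def split: if_splits)

lemma rel_of_odd: "2 * j + 1 \<le> k \<Longrightarrow> rel_of j = 2 * j + 1"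
  by (auto simp: rel_of_def)

lemma coords_less: "t < q ^ d \<Longrightarrow> i < d \<Longrightarrow> coords t i < q"
  using bij_betwE[OF coords] by (auto dest: PiE_mem)

lemma server_with_coords:
  assumes "\<And>i. i < d \<Longrightarrow> l i < q"
  obtains t where "t < q ^ d" "\<And>i. i < d \<Longrightarrow> coords t i = l i"
proof -
  have "restrict l {..<d} \<in> coords ` {..<q ^ d}"
    using assms coords by (auto simp: bij_betw_def)
  then obtain t where "t < q ^ d" "coords t = restrict l {..<d}" by force
  then show ?thesis by (intro that) (auto simp: fun_eq_iff)
qed

lemma server_eqI:
  assumes "s < q ^ d" "t < q ^ d" "\<And>i. i < d \<Longrightarrow> coords s i = coords t i"
  shows "s = t"
proof -
  have "coords s = coords t"
    using bij_betwE[OF coords] assms by (intro PiE_ext[of _ "{..<d}" "\<lambda>_. {..<q}"]) auto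
  then show ?thesis
    using assms(1,2) bij_betw_imp_inj_on[OF coords] by (auto dest: inj_onD)
qed

end

section \<open>Knowledge of the servers for fixed hash functions\<close>

locale line_input = line_grid +
  fixes S :: relations and owner :: "nat \<Rightarrow> nat \<times> nat \<Rightarrow> nat"
  assumes inst: "line_instance k n m S"
    and part: "evenly_partitioned p k m S owner"
begin

abbreviation st :: statistics where
  "st \<equiv> statistics_of p k S"

abbreviation frag :: "nat \<Rightarrow> relations" where
  "frag \<equiv> fragment k S owner"

context
  fixes h :: "nat \<Rightarrow> nat \<Rightarrow> nat"
begin

text \<open>The group depends on the owner of the tuple, since ranks are taken within one
  fragment.\<close>

definition grp :: "nat \<Rightarrow> nat \<times> nat \<Rightarrow> nat" where
  "grp i e = group_of st h i (frag (owner (rel_of i) e) (rel_of i)) e"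

definition sent1 :: "nat \<Rightarrow> nat \<Rightarrow> items" where
  "sent1 s t = message1 st h (frag s) s t"

definition known1 :: "nat \<Rightarrow> items" where
  "known1 t = (\<Union>s<p. sent1 s t)"

definition sent2 :: "nat \<Rightarrow> nat \<Rightarrow> items" where
  "sent2 s t = message2 st h (known1 s) s t"

definition known2 :: "nat \<Rightarrow> items" where
  "known2 t = (\<Union>s<p. sent2 s t)"

lemma S_subset: "j \<in> {1..k} \<Longrightarrow> S j \<subseteq> {1..n} \<times> {1..n}"
  and card_S: "j \<in> {1..k} \<Longrightarrow> card (S j) = m"
  using inst by (auto simp: line_instance_def)

lemma finite_S: "j \<in> {1..k} \<Longrightarrow> finite (S j)"
  using S_subset finite_subset by (metis finite_SigmaI finite_atLeastAtMost)

lemma owner_less: "j \<in> {1..k} \<Longrightarrow> e \<in> S j \<Longrightarrow> owner j e < p"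
  using part by (auto simp: evenly_partitioned_def)

lemma mem_frag_iff: "e \<in> frag s j \<longleftrightarrow> j \<in> {1..k} \<and> e \<in> S j \<and> owner j e = s"
  by (auto simp: fragment_def)

lemma sent1_subset: "sent1 s t \<subseteq> {(j, e). e \<in> frag s j}"
  by (auto simp: sent1_def message1_def)

lemma known1_subset: "known1 t \<subseteq> {(j, e). j \<in> {1..k} \<and> e \<in> S j}"
  using sent1_subset by (force simp: known1_def mem_frag_iff)

lemma sent2_subset: "sent2 s t \<subseteq> known1 s"
  by (auto simp: sent2_def message2_def)

lemma known2_subset: "known2 t \<subseteq> {(j, e). j \<in> {1..k} \<and> e \<in> S j}"
  using sent2_subset known1_subset by (fastforce simp: known2_def)

lemma items_subset: "{(j, e). j \<in> {1..k} \<and> e \<in> S j} \<subseteq> {1..k} \<times> {1..n} \<times> {1..n}"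
  using S_subset by fastforce

lemma sent1_le: "sent1 s t \<subseteq> {1..k} \<times> {1..n} \<times> {1..n}"
  using sent1_subset[of s t] items_subset by (force simp: mem_frag_iff)

lemma sent2_le: "sent2 s t \<subseteq> {1..k} \<times> {1..n} \<times> {1..n}"
  using sent2_subset known1_subset items_subset by (meson order_trans)

lemma span_of_pos: "span_of st i z \<ge> 1"
proof -
  have "nat \<lceil>real f * real q / real m\<rceil> \<ge> 1" if "real f > real m / real p" for f
  proof -
    have "real f > 0" using that by (meson divide_nonneg_nonneg le_less_trans of_nat_0_le_iff)
    then have "real f * real q / real m > 0" using q m by simp
    then show ?thesis by linarith
  qed
  then show ?thesis
    using card_S[OF rel_of_bounds] by (auto simp: span_of_def statistics_of_def)
qed

lemma grp_mem_targets: "grp i e \<in> targets st h i (key i e)"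
  using span_of_pos[of i "key i e"] unfolding grp_def group_of_def targets_def cyclic_arc_def
  by (intro image_eqI[where x = "rank i (frag (owner (rel_of i) e) (rel_of i)) e mod
      span_of st i (key i e)"]) simp_all

lemma grp_less: "grp i e < q"
  using q by (simp add: grp_def group_of_def)

lemma grouped_mem_known1:
  assumes "i < d" "t < q ^ d" "e \<in> S (rel_of i)" "grp i e = coords t i"
  shows "(rel_of i, e) \<in> known1 t"
proof -
  have "(rel_of i, e) \<in> sent1 (owner (rel_of i) e) t"
    unfolding sent1_def
  proof (rule message1_coordinateI[OF assms(2,1)])
    show "e \<in> frag (owner (rel_of i) e) (rel_of i)"
      using assms(3) rel_of_bounds[of i] by (simp add: mem_frag_iff)
  qed (use assms(4) in \<open>simp add: grp_def\<close>)
  then show ?thesis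
    unfolding known1_def using owner_less[OF rel_of_bounds assms(3)] by blast
qed

text \<open>Relations of odd index travel only by the first clause of \<open>message1\<close>;
  parity rules out the other two.\<close>

lemma known1_grouped:
  assumes "(rel_of j, e) \<in> known1 t" "2 * j + 1 \<le> k"
  shows "e \<in> S (rel_of j) \<and> grp j e = coords t j"
proof -
  have j: "rel_of j = 2 * j + 1" using rel_of_odd assms by simp
  from assms(1) obtain s where "(2 * j + 1, e) \<in> sent1 s t" unfolding known1_def j by blast
  then show ?thesis
    unfolding sent1_def
  proof (cases rule: message1_cases)
    case (coordinate i)
    then have i: "i = j" using rel_of_eq_odd[OF _ assms(2)] by metis
    show ?thesis
      using coordinate(4,5) unfolding i j[symmetric] by (simp add: grp_def mem_frag_iff)
  next
    case second
    from second(2) have False by presburger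
    then show ?thesis ..
  next
    case (connecting i)
    from connecting(2) have False by presburger
    then show ?thesis ..
  qed
qed

text \<open>The servers that know a tuple form the grid line in direction \<open>i - 1\<close>
  through the point given by its owner. Such a line meets every group of
  \<open>rel_of (i - 1)\<close> exactly once.\<close>

lemma known1_connecting_iff:
  assumes "2 \<le> i" "2 * i < k"
  shows "(2 * i, e) \<in> known1 t \<longleftrightarrow> t < q ^ d \<and> e \<in> S (2 * i) \<and>
    (\<forall>i'<d. i' \<noteq> i - 1 \<longrightarrow> coords t i' = coords (owner (2 * i) e mod q ^ d) i')"
proof
  assume "(2 * i, e) \<in> known1 t"
  then obtain s where s: "(2 * i, e) \<in> sent1 s t" by (auto simp: known1_def)
  then show "t < q ^ d \<and> e \<in> S (2 * i) \<and>
    (\<forall>i'<d. i' \<noteq> i - 1 \<longrightarrow> coords t i' = coords (owner (2 * i) e mod q ^ d) i')"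
    unfolding sent1_def
  proof (cases rule: message1_cases)
    case (coordinate i')
    then show ?thesis using connecting_rel_neq_rel_of[OF assms(2), of i'] by simp
  next
    case (connecting i')
    then have "i' = i" by simp
    with connecting show ?thesis by (simp add: mem_frag_iff)
  qed (use assms in simp)
next
  assume "t < q ^ d \<and> e \<in> S (2 * i) \<and>
    (\<forall>i'<d. i' \<noteq> i - 1 \<longrightarrow> coords t i' = coords (owner (2 * i) e mod q ^ d) i')"
  then have *: "t < q ^ d" "e \<in> S (2 * i)"
    "\<And>i'. i' < d \<Longrightarrow> i' \<noteq> i - 1 \<Longrightarrow> coords t i' = coords (owner (2 * i) e mod q ^ d) i'"
    by auto
  have "(2 * i, e) \<in> sent1 (owner (2 * i) e) t"
    unfolding sent1_def using assms *
    by (intro message1_connectingI) (auto simp: mem_frag_iff)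
  then show "(2 * i, e) \<in> known1 t"
    using owner_less[of "2 * i" e] assms * by (auto simp: known1_def)
qed

lemma second_relation_mem_known1:
  assumes "2 < k" "t < q ^ d" "e \<in> S 2" "coords t 0 \<in> targets st h 0 (fst e)"
    "coords t 1 \<in> targets st h 1 (snd e)"
  shows "(2, e) \<in> known1 t"
proof -
  have "(2, e) \<in> sent1 (owner 2 e) t"
    unfolding sent1_def using assms by (intro message1_secondI) (auto simp: mem_frag_iff)
  then show ?thesis
    using owner_less[of 2 e] assms by (auto simp: known1_def)
qed

section \<open>Correctness\<close>

text \<open>The answer is assembled at the grid point \<open>t\<close> whose \<open>i\<close>-th
  coordinate is the group of the answer's tuple in \<open>rel_of i\<close>.\<close>

lemma answer_known:
  assumes xs: "xs \<in> line_query k S"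
  obtains t where "t < q ^ d"
    "\<And>j. j \<in> {1..k} \<Longrightarrow> (j, xs ! (j - 1), xs ! j) \<in> known1 t \<union> (if k \<le> 3 then {} else known2 t)"
proof -
  define e where "e j = (xs ! (j - 1), xs ! j)" for j
  have e: "e j \<in> S j" if "j \<in> {1..k}" for j
    using xs that by (auto simp: line_query_def e_def)
  define l where "l i = grp i (e (rel_of i))" for i
  obtain t where t: "t < q ^ d" "\<And>i. i < d \<Longrightarrow> coords t i = l i"
    using server_with_coords[of l] grp_less by (auto simp: l_def)
  have "(j, e j) \<in> known1 t \<union> (if k \<le> 3 then {} else known2 t)" if j: "j \<in> {1..k}" for j
  proof -
    consider (coordinate) i where "i < d" "j = rel_of i" | (second) "j = 2" "2 < k"
      | (connecting) i where "j = 2 * i" "2 \<le> i" "2 * i < k"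
    proof (cases "odd j \<or> j = k")
      case True
      then have "j div 2 < d" "j = rel_of (j div 2)"
        using j d by (auto simp: rel_of_def min_def div_le_mono elim!: oddE)
      then show ?thesis using that(1) by blast
    next
      case False
      then have j': "j = 2 * (j div 2)" "j < k" using j by auto
      show ?thesis
      proof (cases "j = 2")
        case False
        then have "2 \<le> j div 2" using j j' by presburger
        then show ?thesis using that(3)[of "j div 2"] j' by metis
      qed (use that(2) j' in metis)
    qed
    then show ?thesis
    proof cases
      case coordinate
      then show ?thesis
        using grouped_mem_known1[of i t "e j"] t e[OF j] by (auto simp: l_def)
    next
      case second
      have "rel_of 0 = 1" "rel_of 1 = 3" "1 < d" using second d by (auto simp: rel_of_def)
      then show ?thesis
        using second_relation_mem_known1[of t "e 2"] second t e[OF j]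
          grp_mem_targets[of 0 "e 1"] grp_mem_targets[of 1 "e 3"]
        by (auto simp: l_def e_def col_of_def)
    next
      case connecting
      \<comment> \<open>The relay server \<open>s\<close> is the point on the line of this tuple
        whose coordinate \<open>i - 1\<close> agrees with \<open>t\<close>. There the tuple meets
        its partner from \<open>rel_of (i - 1)\<close>, survives the semijoin and is forwarded to
        \<open>t\<close>.\<close>
      let ?s0 = "owner j (e j) mod q ^ d"
      have s0: "?s0 < q ^ d" using q by simp
      have "((coords ?s0)(i - 1 := l (i - 1))) i' < q" if "i' < d" for i'
        using coords_less[OF s0 that] grp_less by (simp add: l_def)
      then obtain s where s: "s < q ^ d"
          "\<And>i'. i' < d \<Longrightarrow> coords s i' = ((coords ?s0)(i - 1 := l (i - 1))) i'"
        using server_with_coords by blast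
      have i: "i < d" "i - 1 < d" using connecting d by auto
      have r: "rel_of (i - 1) = 2 * i - 1" "rel_of i = 2 * i + 1" "2 * (i - 1) + 1 \<le> k"
        using connecting by (auto simp: rel_of_def)
      have 1: "(2 * i, e j) \<in> known1 s"
        using known1_connecting_iff[of i "e j" s] connecting s e[OF j] by auto
      have "e (2 * i - 1) \<in> S (2 * i - 1)" using connecting by (intro e) auto
      then have "(2 * i - 1, e (2 * i - 1)) \<in> known1 s"
        using grouped_mem_known1[of "i - 1" s "e (2 * i - 1)"] i s r by (auto simp: l_def)
      then have 2: "(rel_of (i - 1), xs ! (2 * i - 2), fst (e j)) \<in> known1 s"
        using connecting r by (simp add: e_def numeral_2_eq_2)
      have "coords t i \<in> targets st h i (snd (e j))"
        using grp_mem_targets[of i "e (2 * i + 1)"] t(2)[OF i(1)] r connecting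
        by (auto simp: l_def e_def col_of_def)
      moreover have "coords t (i - 1) = coords s (i - 1)"
        using s(2)[OF i(2)] t(2)[OF i(2)] by simp
      ultimately have "(2 * i, e j) \<in> sent2 s t"
        unfolding sent2_def using s(1) t(1) connecting(2,3) 1 2 by (intro message2I)
      moreover have "s < p" using s(1) q by simp
      ultimately have "(j, e j) \<in> known2 t"
        unfolding known2_def connecting(1) by blast
      then show ?thesis using connecting by auto
    qed
  qed
  then show ?thesis using that[OF t(1)] by (simp add: e_def)
qed

section \<open>Views and messages in an actual run\<close>

context
  fixes \<omega> :: nat
  assumes \<omega>: "hash_of_seed \<omega> = h"
begin

abbreviation V :: "nat \<Rightarrow> view" where
  "V \<equiv> initial_view p k S owner \<omega>"

lemma dec_enc: "X \<subseteq> {1..k} \<times> {1..n} \<times> {1..n} \<Longrightarrow>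
    inv_into (Pow ({1..k} \<times> {1..n} \<times> {1..n})) enc (enc X) = X"
  using enc by (intro inv_into_f_f) auto

lemma send_algorithm: "send algorithm s t v = enc (
    if inboxes v = [] then message1 (stats v) (hash_of_seed (seed v)) (local_input v) s t
    else message2 (stats v) (hash_of_seed (seed v)) (items_received v 0) s t)"
  by (simp add: algorithm_def)

lemma send_first: "send algorithm s t (V s) = enc (sent1 s t)"
  by (simp add: send_algorithm initial_view_def sent1_def \<omega>)

lemma view_after_first: "view_after algorithm p V (Suc 0) s =
    (V s)\<lparr>inboxes := [\<lambda>t. if t < p then enc (sent1 t s) else []]\<rparr>"
  using send_first by (simp add: initial_view_def cong: if_cong)

lemma items_received_first: "items_received (view_after algorithm p V (Suc 0) s) 0 = known1 s"
  unfolding view_after_first items_received_def known1_def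
  using dec_enc[OF sent1_le] by simp

lemma send_second: "send algorithm s t (view_after algorithm p V (Suc 0) s) = enc (sent2 s t)"
proof -
  let ?v = "view_after algorithm p V (Suc 0) s"
  have "inboxes ?v \<noteq> []" "stats ?v = st" "seed ?v = \<omega>"
    unfolding view_after_first by (simp_all add: initial_view_def)
  then show ?thesis
    unfolding sent2_def by (simp add: send_algorithm items_received_first \<omega> del: view_after.simps)
qed

lemma view_after_second: "view_after algorithm p V 2 s =
    (V s)\<lparr>inboxes := [\<lambda>t. if t < p then enc (sent1 t s) else [],
                     \<lambda>t. if t < p then enc (sent2 t s) else []]\<rparr>"
proof -
  have "view_after algorithm p V 2 s = (view_after algorithm p V (Suc 0) s)
      \<lparr>inboxes := inboxes (view_after algorithm p V (Suc 0) s) @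
        [\<lambda>t. if t < p then send algorithm t s (view_after algorithm p V (Suc 0) t) else []]\<rparr>"
    unfolding numeral_2_eq_2 by (subst view_after.simps(2)) (rule refl)
  then show ?thesis unfolding send_second by (simp add: view_after_first del: view_after.simps)
qed

lemma items_received_final:
  defines "v \<equiv> view_after algorithm p V (rounds algorithm)"
  shows "(\<Union>r<length (inboxes (v s)). items_received (v s) r) =
    known1 s \<union> (if k \<le> 3 then {} else known2 s)"
proof (cases "k \<le> 3")
  case True
  then have "v = view_after algorithm p V (Suc 0)" by (simp add: v_def algorithm_def)
  moreover have "length (inboxes (view_after algorithm p V (Suc 0) s)) = 1"
    by (simp add: view_after_first del: view_after.simps)
  ultimately show ?thesis using True items_received_first by (simp add: lessThan_Suc del: view_after.simps)
next
  case False
  then have v: "v = view_after algorithm p V 2" by (simp add: v_def algorithm_def)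
  have "items_received (v s) 0 = known1 s" "items_received (v s) 1 = known2 s"
    unfolding v view_after_second items_received_def known1_def known2_def
    using dec_enc[OF sent1_le] dec_enc[OF sent2_le] by simp_all
  moreover have "length (inboxes (v s)) = 2"
    unfolding v view_after_second by simp
  ultimately show ?thesis
    using False by (auto simp: numeral_2_eq_2 lessThan_Suc)
qed

lemma output_correct: "mpc_output algorithm p V = line_query k S"
proof -
  have ans: "answers algorithm s (view_after algorithm p V (rounds algorithm) s) =
      {xs. length xs = k + 1 \<and> (\<forall>j\<in>{1..k}. (j, xs ! (j - 1), xs ! j) \<in>
         known1 s \<union> (if k \<le> 3 then {} else known2 s))}" for s
    unfolding items_received_final[symmetric] by (simp add: algorithm_def)
  show ?thesis
  proof
    show "mpc_output algorithm p V \<subseteq> line_query k S"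
      using known1_subset known2_subset
      by (fastforce simp: mpc_output_def ans line_query_def split: if_splits)
    show "line_query k S \<subseteq> mpc_output algorithm p V"
    proof
      fix xs assume xs: "xs \<in> line_query k S"
      then obtain t where t: "t < q ^ d"
        "\<And>j. j \<in> {1..k} \<Longrightarrow> (j, xs ! (j - 1), xs ! j) \<in> known1 t \<union> (if k \<le> 3 then {} else known2 t)"
        using answer_known by blast
      then have "t < p" using q by simp
      then show "xs \<in> mpc_output algorithm p V"
        using t(2) xs unfolding mpc_output_def ans
        by (intro UN_I[of t]) (simp_all add: line_query_def)
    qed
  qed
qed

text \<open>Every tuple has one owner, so the messages arriving at \<open>t\<close> are disjoint and
  their lengths add up without repetition.\<close>

lemma bits_received_first: "bits_received algorithm p V 0 t = w * card (known1 t)"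
proof -
  have "sent1 s t \<inter> sent1 s' t = {}" if "s \<noteq> s'" for s s'
    using sent1_subset[of s t] sent1_subset[of s' t] that by (force simp: mem_frag_iff)
  then have "card (known1 t) = (\<Sum>s<p. card (sent1 s t))"
    unfolding known1_def
    by (intro card_UN_disjoint) (auto intro: finite_subset[OF sent1_le])
  then show ?thesis
    by (simp add: bits_received_def send_first length_enc[OF sent1_le] sum_distrib_left)
qed

text \<open>Senders of the same tuple lie on a common line in direction \<open>i - 1\<close> and
  must agree with \<open>t\<close> in that coordinate, so there is only one.\<close>

lemma bits_received_second: "bits_received algorithm p V (Suc 0) t = w * card (known2 t)"
proof -
  have "s = s'" if x: "x \<in> sent2 s t" "x \<in> sent2 s' t" for s s' x
  proof -
    from x obtain i e where i: "x = (2 * i, e)" "2 \<le> i" "2 * i < k" "s < q ^ d" "(2 * i, e) \<in> known1 s"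
        "coords t (i - 1) = coords s (i - 1)"
      by (auto simp: sent2_def message2_def split: if_splits)
    from x i(1) have i': "s' < q ^ d" "(2 * i, e) \<in> known1 s'" "coords t (i - 1) = coords s' (i - 1)"
      by (auto simp: sent2_def message2_def split: if_splits)
    have "coords s i' = coords s' i'" if "i' < d" for i'
      using i i' that known1_connecting_iff[OF i(2,3)] by metis
    then show ?thesis using server_eqI i(4) i'(1) by blast
  qed
  then have "card (known2 t) = (\<Sum>s<p. card (sent2 s t))"
    unfolding known2_def
    by (intro card_UN_disjoint) (auto intro: finite_subset[OF sent2_le])
  then show ?thesis
    using send_second
    by (simp add: bits_received_def length_enc[OF sent2_le] sum_distrib_left del: view_after.simps
        One_nat_def)
qed

lemma mpc_load_le:
  assumes "\<And>t. t < p \<Longrightarrow> card (known1 t) \<le> C" "\<And>t. t < p \<Longrightarrow> card (known2 t) \<le> C"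
  shows "mpc_load algorithm p V \<le> w * C"
proof -
  let ?B = "{bits_received algorithm p V r s | r s. r < rounds algorithm \<and> s < p}"
  have "?B \<subseteq> (\<lambda>(r, s). bits_received algorithm p V r s) ` ({..<2} \<times> {..<p})"
    by (auto simp: algorithm_def)
  then have fin: "finite ?B" by (rule finite_subset) simp
  have "x \<le> w * C" if "x \<in> ?B" for x
  proof -
    from that obtain r s where rs: "x = bits_received algorithm p V r s" "r < 2" "s < p"
      by (auto simp: algorithm_def split: if_splits)
    then have "r = 0 \<or> r = 1" by auto
    then show ?thesis
      using rs assms bits_received_first bits_received_second by auto
  qed
  then show ?thesis unfolding mpc_load_def using fin by simp
qed

end

end

end

section \<open>Frequencies and arc lengths on large inputs\<close>

lemma (in line_grid) q_le_p: "q \<le> p"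
  using q d by (metis Suc_eq_plus1 le_trans self_le_power zero_less_Suc)

text \<open>Each of the \<open>p\<close> servers may lose one tuple per key to rounding; the
  assumption keeps this loss within the ideal group size \<open>m / q\<close>.\<close>

locale large_line_input = line_input +
  assumes m_ge: "p * q \<le> m"
begin

definition L :: real where
  "L = real m / real q"

lemma L_pos: "L > 0"
  using q m by (simp add: L_def)

lemma p_le_L: "real p \<le> L"
proof -
  have "real p * real q \<le> real m" using m_ge by (metis of_nat_le_iff of_nat_mult)
  then show ?thesis using q by (simp add: L_def pos_le_divide_eq)
qed

abbreviation deg :: "nat \<Rightarrow> nat \<Rightarrow> nat" where
  "deg i z \<equiv> card {e \<in> S (rel_of i). key i e = z}"

abbreviation span :: "nat \<Rightarrow> nat \<Rightarrow> nat" where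
  "span i z \<equiv> span_of st i z"

lemma key_range: "j \<in> {1..k} \<Longrightarrow> e \<in> S j \<Longrightarrow> column_of c e \<in> {1..n}"
  using S_subset[of j] by (cases c; cases e) auto

lemma sum_column_card:
  assumes "j \<in> {1..k}"
  shows "(\<Sum>z=1..n. card {e \<in> S j. column_of c e = z}) = m"
proof -
  have "(\<Sum>z=1..n. card {e \<in> S j. column_of c e = z}) = card (S j)"
    by (rule card_fibres) (use finite_S key_range assms in auto)
  then show ?thesis using card_S assms by simp
qed

lemma deg_le: "deg i z \<le> m"
  using card_S[OF rel_of_bounds] finite_S[OF rel_of_bounds]
  by (metis (no_types, lifting) card_mono mem_Collect_eq subsetI)

text \<open>For heavy hitters the span is \<open>deg i z / L\<close> rounded up. A span of at least
  2 forces this quotient above 1, so rounding at most doubles it; \<open>deg i z <= m\<close> bounds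
  it by \<open>q\<close>.\<close>

lemma deg_le_span: "deg i z \<le> L * span i z"
  and span_le: "span i z \<ge> 2 \<Longrightarrow> L * span i z \<le> 2 * deg i z"
  and span_le_q: "span i z \<le> q"
proof -
  let ?x = "real (deg i z) * real q / real m"
  have x_le: "?x \<le> q"
    using deg_le[of i z] m by (simp add: divide_le_eq mult.commute[of "real q"] mult_right_mono)
  have *: "deg i z \<le> L * span i z \<and> (span i z \<ge> 2 \<longrightarrow> L * span i z \<le> 2 * deg i z) \<and> span i z \<le> q"
  proof (cases "real (deg i z) > real m / real p")
    case True
    then have s: "span i z = nat \<lceil>?x\<rceil>"
      using card_S[OF rel_of_bounds] rel_of_bounds[of i]
      by (auto simp: span_of_def statistics_of_def frequency_def)
    have "?x \<ge> 0" by simp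
    then have "real (span i z) = of_int \<lceil>?x\<rceil>" unfolding s by simp
    then have r: "?x \<le> span i z" "span i z < ?x + 1" by linarith+
    have "span i z < real q + 1" using r x_le by linarith
    then have "span i z \<le> q" by linarith
    moreover have "L * span i z \<le> 2 * deg i z" if "span i z \<ge> 2"
    proof -
      have "span i z \<le> 2 * ?x" using r that by linarith
      then have "L * span i z \<le> L * (2 * ?x)" using L_pos by (intro mult_left_mono) auto
      also have "\<dots> = 2 * deg i z" using q m by (simp add: L_def)
      finally show ?thesis .
    qed
    moreover have "deg i z \<le> L * span i z"
    proof -
      have "L * ?x \<le> L * span i z" using r L_pos by (intro mult_left_mono) auto
      moreover have "L * ?x = deg i z" using q m by (simp add: L_def)
      ultimately show ?thesis by simp
    qed
    ultimately show ?thesis by blast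
  next
    case False
    then have s: "span i z = 1"
      using card_S[OF rel_of_bounds]
      by (auto simp: span_of_def statistics_of_def frequency_def)
    have "real m / real p \<le> L"
      unfolding L_def using q q_le_p by (intro divide_left_mono) auto
    then show ?thesis using False s q by simp
  qed
  show "deg i z \<le> L * span i z" "span i z \<ge> 2 \<Longrightarrow> L * span i z \<le> 2 * deg i z" "span i z \<le> q"
    using * by blast+
qed

text \<open>Long arcs are paid for by degrees, which sum to \<open>m = L * q\<close>. This is the
  premise \<open>long\<close> of \<open>arc_weight_tail\<close>.\<close>

lemma sum_long_spans: "(\<Sum>z | z \<in> {1..n} \<and> span i z \<ge> 2. span i z) \<le> 2 * q"
proof -
  have "L * (\<Sum>z | z \<in> {1..n} \<and> span i z \<ge> 2. span i z)
      = (\<Sum>z | z \<in> {1..n} \<and> span i z \<ge> 2. L * span i z)"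
    by (simp add: sum_distrib_left)
  also have "\<dots> \<le> (\<Sum>z | z \<in> {1..n} \<and> span i z \<ge> 2. 2 * real (deg i z))"
    using span_le by (intro sum_mono) auto
  also have "\<dots> \<le> (\<Sum>z=1..n. 2 * real (deg i z))"
    by (intro sum_mono2) auto
  also have "\<dots> = 2 * m"
    using sum_column_card[OF rel_of_bounds, of i "col_of i"]
    by (simp flip: sum_distrib_left of_nat_sum)
  also have "\<dots> = L * (2 * q)" using q by (simp add: L_def)
  finally show ?thesis
    using L_pos by (simp only: mult_le_cancel_left_pos of_nat_le_iff)
qed

section \<open>Concentration of the load\<close>

text \<open>The weights may depend on all hash functions except the one at \<open>i\<close>. Their
  range condition is part of the event because it may fail for some outcomes of the others; the
  event is then empty.\<close>

lemma hashes_tail: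
  fixes W :: "(nat \<Rightarrow> nat \<Rightarrow> nat) \<Rightarrow> nat \<Rightarrow> real" and B s :: real
  assumes i: "i < d" and l: "l < q" and B: "B > 0"
    and indep: "\<And>h x z. W (h(i := x)) z = W h z"
    and total: "\<And>h. (\<Sum>z=1..n. W h z) \<le> B * q"
  shows "measure_pmf.prob hashes {h. (\<forall>z\<in>{1..n}. 0 \<le> W h z \<and> W h z \<le> B) \<and>
      (\<Sum>z=1..n. W h z * indicator (targets st h i z) l) > B * s} \<le> exp (6 - s)"
proof -
  define Q where "Q h g \<longleftrightarrow> (\<forall>z\<in>{1..n}. 0 \<le> W h z \<and> W h z \<le> B) \<and>
      (\<Sum>z=1..n. W h z * indicator (cyclic_arc q (g z) (span i z)) l) > B * s" for h g
  have "measure_pmf.prob hashes {h. Q h (h i)} \<le> exp (6 - s)"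
    unfolding hashes_def
  proof (rule prob_Pi_pmf_coordinate_le)
    show "Q (g(i := x)) y = Q g y" for g x y
      unfolding Q_def by (simp only: indep)
    show "measure_pmf.prob (hash n q) {x. Q g x} \<le> exp (6 - s)" for g
    proof (cases "\<forall>z\<in>{1..n}. 0 \<le> W g z \<and> W g z \<le> B")
      case True
      then have "{x. Q g x} =
          {x. (\<Sum>z=1..n. W g z * indicator (cyclic_arc q (x z) (span i z)) l) > B * s}"
        by (auto simp: Q_def)
      then show ?thesis
        using arc_weight_tail[OF q(1) l, of n "W g" B "span i" s] True total sum_long_spans B by simp
    next
      case False
      then have "{x. Q g x} = {}" by (auto simp: Q_def)
      then show ?thesis by simp
    qed
  qed (use i in auto)
  then show ?thesis by (simp add: Q_def targets_def)
qed

text \<open>One \<open>L\<close> pays for the even share of a key in a group, the other for the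
  rounding loss \<open>p\<close>.\<close>

definition B :: real where
  "B = 2 * L"

lemma B_pos: "B > 0"
  using L_pos by (simp add: B_def)

lemma m_le_B: "m \<le> B * q"
  using q m by (simp add: B_def L_def)

text \<open>The summand \<open>p\<close> accounts for the rounding when each of the \<open>p\<close> servers deals out its tuples.\<close>

definition share :: "nat \<Rightarrow> nat \<Rightarrow> real" where
  "share i z = min (real (deg i z)) (real (deg i z) / real (span i z) + real p)"

lemma share_nonneg: "share i z \<ge> 0"
  by (simp add: share_def)

lemma share_le: "share i z \<le> B"
proof -
  have "real (deg i z) / real (span i z) \<le> L"
    using deg_le_span[of i z] span_of_pos[of i z] by (simp add: pos_divide_le_eq)
  then show ?thesis using p_le_L by (simp add: share_def B_def)
qed

lemma sum_share: "(\<Sum>z=1..n. share i z) \<le> B * q"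
proof -
  \<comment> \<open>The first argument of \<open>min\<close> matters here: summed over all keys, the
    rounding terms \<open>p\<close> alone could exceed \<open>m\<close>.\<close>
  have "(\<Sum>z=1..n. share i z) \<le> (\<Sum>z=1..n. real (deg i z))"
    by (intro sum_mono) (simp add: share_def)
  also have "\<dots> = m"
    using sum_column_card[OF rel_of_bounds, of i "col_of i"] by (simp flip: of_nat_sum)
  finally show ?thesis using m_le_B by simp
qed

definition grouped :: "(nat \<Rightarrow> nat \<Rightarrow> nat) \<Rightarrow> nat \<Rightarrow> nat \<Rightarrow> (nat \<times> nat) set" where
  "grouped h i l = {e \<in> S (rel_of i). grp h i e = l}"

lemma finite_grouped: "finite (grouped h i l)"
  using finite_S[OF rel_of_bounds] by (simp add: grouped_def)

text \<open>Within one server, the tuples of a key that land in a fixed group share a rank residue,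
  so \<open>card_rank_mod_le\<close> applies. Summing over the servers turns the additive 1 into
  \<open>p\<close>.\<close>

lemma card_grouped_key_le:
  "card {e \<in> grouped h i l. key i e = z} \<le> share i z * indicator (targets st h i z) l"
proof (cases "l \<in> targets st h i z")
  case False
  then have "{e \<in> grouped h i l. key i e = z} = {}"
    using grp_mem_targets[of h i] by (auto simp: grouped_def)
  then show ?thesis using False by (simp only:) simp
next
  case True
  let ?F = "\<lambda>s. {e \<in> frag s (rel_of i). key i e = z}"
  let ?G = "\<lambda>s. {e \<in> ?F s. grp h i e = l}"
  have fr: "e \<in> frag s (rel_of i) \<longleftrightarrow> e \<in> S (rel_of i) \<and> owner (rel_of i) e = s" for e s
    using rel_of_bounds by (simp add: mem_frag_iff)
  have finF: "finite (?F s)" for s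
    using finite_S[OF rel_of_bounds, of i] by (rule rev_finite_subset) (auto simp: fr)
  have "card (?G s) \<le> card (?F s) div span i z + 1" for s
  proof (cases "?G s = {}")
    case True
    show ?thesis unfolding True by simp
  next
    case False
    then obtain e0 where e0: "e0 \<in> ?G s" by blast
    define x where "x = rank i (frag s (rel_of i)) e0 mod span i z"
    have grp_eq: "grp h i e = (h i z + rank i (frag s (rel_of i)) e mod span i z) mod q"
      if "e \<in> ?F s" for e
      using that by (simp add: grp_def group_of_def fr)
    \<comment> \<open>As the span is at most \<open>q\<close>, different offsets along the arc give
      different groups.\<close>
    have "rank i (frag s (rel_of i)) e mod span i z = x" if "e \<in> ?G s" for e
    proof (rule add_mod_left_cancel)
      show "(h i z + rank i (frag s (rel_of i)) e mod span i z) mod q = (h i z + x) mod q"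
        using that e0 grp_eq[of e] grp_eq[of e0] by (simp add: x_def)
      show "rank i (frag s (rel_of i)) e mod span i z < q" "x < q"
        using span_of_pos[of i z] span_le_q[of i z] unfolding x_def
        by (meson le_trans mod_less_divisor not_less not_less_eq_eq less_le_trans zero_less_one
            less_numeral_extra(1))+
    qed
    then have "?G s \<subseteq> {e \<in> ?F s. rank i (frag s (rel_of i)) e mod span i z = x}" by blast
    also have "\<dots> = {e \<in> ?F s. card {e' \<in> ?F s. prod_encode e' < prod_encode e} mod span i z = x}"
      by (auto simp: rank_def)
    finally have "card (?G s) \<le>
        card {e \<in> ?F s. card {e' \<in> ?F s. prod_encode e' < prod_encode e} mod span i z = x}"
      by (intro card_mono finite_subset[OF _ finF[of s]]) auto
    also have "\<dots> \<le> card (?F s) div span i z + 1"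
      using finF span_of_pos by (intro card_rank_mod_le) (auto simp: inj_on_def)
    finally show ?thesis .
  qed
  then have G_le: "card (?G s) \<le> real (card (?F s)) / span i z + 1" for s
  proof -
    have "real (card (?G s)) \<le> real (card (?F s) div span i z + 1)"
      using \<open>card (?G s) \<le> card (?F s) div span i z + 1\<close> by (rule of_nat_mono)
    also have "\<dots> \<le> card (?F s) / span i z + 1"
      using of_nat_div_le_of_nat[of "card (?F s)" "span i z"] by simp
    finally show ?thesis .
  qed
  have owner_p: "e \<in> S (rel_of i) \<Longrightarrow> owner (rel_of i) e < p" for e
    using owner_less[OF rel_of_bounds] .
  have un: "{e \<in> grouped h i l. key i e = z} = (\<Union>s<p. ?G s)"
    using owner_p by (auto simp: grouped_def fr)
  have "(\<Sum>s<p. card (?F s)) = card (\<Union>s<p. ?F s)"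
    using finF by (intro card_UN_disjoint[symmetric]) (auto simp: fr)
  also have "(\<Union>s<p. ?F s) = {e \<in> S (rel_of i). key i e = z}"
    using owner_p by (auto simp: fr)
  finally have sumF: "(\<Sum>s<p. card (?F s)) = deg i z" .
  have "card {e \<in> grouped h i l. key i e = z} \<le> (\<Sum>s<p. card (?G s))"
    unfolding un by (rule card_UN_le) simp
  then have "real (card {e \<in> grouped h i l. key i e = z}) \<le> (\<Sum>s<p. real (card (?G s)))"
    by (simp flip: of_nat_sum)
  also have "\<dots> \<le> (\<Sum>s<p. real (card (?F s)) / span i z + 1)"
    using G_le by (intro sum_mono)
  also have "\<dots> = real (deg i z) / span i z + p"
    using sumF by (simp add: sum.distrib flip: sum_divide_distrib of_nat_sum)
  finally have "real (card {e \<in> grouped h i l. key i e = z}) \<le> real (deg i z) / span i z + p" .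
  moreover have "card {e \<in> grouped h i l. key i e = z} \<le> deg i z"
    using finite_S[OF rel_of_bounds] by (intro card_mono) (auto simp: grouped_def)
  ultimately show ?thesis using True by (simp add: share_def)
qed

lemma card_grouped_le:
  "card (grouped h i l) \<le> (\<Sum>z=1..n. share i z * indicator (targets st h i z) l)"
proof -
  have "key i ` grouped h i l \<subseteq> {1..n}"
    using key_range[OF rel_of_bounds[of i]] unfolding grouped_def by blast
  then have "card (grouped h i l) = (\<Sum>z=1..n. card {e \<in> grouped h i l. key i e = z})"
    by (rule card_fibres[OF finite_grouped finite_atLeastAtMost, symmetric])
  then have "real (card (grouped h i l)) = (\<Sum>z=1..n. real (card {e \<in> grouped h i l. key i e = z}))"
    by (simp only: of_nat_sum)
  also have "\<dots> \<le> (\<Sum>z=1..n. share i z * indicator (targets st h i z) l)"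
    by (rule sum_mono) (rule card_grouped_key_le)
  finally show ?thesis .
qed

section \<open>Loads of the connecting relations as weighted sums over random arcs\<close>

lemma card_connecting_eq:
  assumes "j \<in> {1..k}"
  shows "real (card {e \<in> S j. P e \<and> l \<in> T (snd e)}) =
    (\<Sum>z=1..n. real (card {e \<in> S j. snd e = z \<and> P e}) * indicator (T z) l)"
proof -
  have "finite {e \<in> S j. P e \<and> l \<in> T (snd e)}"
    using finite_S[OF assms] by simp
  moreover have "snd ` {e \<in> S j. P e \<and> l \<in> T (snd e)} \<subseteq> {1..n}"
  proof
    fix z assume "z \<in> snd ` {e \<in> S j. P e \<and> l \<in> T (snd e)}"
    then obtain e where "e \<in> S j" "z = snd e" by blast
    then show "z \<in> {1..n}" using S_subset[OF assms] by (metis mem_Times_iff subsetD)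
  qed
  ultimately have "card {e \<in> S j. P e \<and> l \<in> T (snd e)} =
      (\<Sum>z=1..n. card {e \<in> {e \<in> S j. P e \<and> l \<in> T (snd e)}. snd e = z})"
    by (intro card_fibres[symmetric] finite_atLeastAtMost)
  then have "real (card {e \<in> S j. P e \<and> l \<in> T (snd e)}) =
      (\<Sum>z=1..n. real (card {e \<in> {e \<in> S j. P e \<and> l \<in> T (snd e)}. snd e = z}))"
    by (simp only: of_nat_sum)
  also have "\<dots> = (\<Sum>z=1..n. real (card {e \<in> S j. snd e = z \<and> P e}) * indicator (T z) l)"
  proof (rule sum.cong)
    fix z
    have "{e \<in> {e \<in> S j. P e \<and> l \<in> T (snd e)}. snd e = z} =
        (if l \<in> T z then {e \<in> S j. snd e = z \<and> P e} else {})" by auto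
    then show "real (card {e \<in> {e \<in> S j. P e \<and> l \<in> T (snd e)}. snd e = z}) =
        real (card {e \<in> S j. snd e = z \<and> P e}) * indicator (T z) l" by simp
  qed simp
  finally show ?thesis .
qed

lemma sum_connecting_le:
  assumes "j \<in> {1..k}" "C \<ge> 1"
  shows "(\<Sum>z=1..n. real (card {e \<in> S j. snd e = z \<and> P e})) \<le> (B * C) * q"
proof -
  have snd_eq: "column_of Second e = snd e" for e by (cases e) simp
  have "(\<Sum>z=1..n. card {e \<in> S j. snd e = z \<and> P e}) \<le> (\<Sum>z=1..n. card {e \<in> S j. snd e = z})"
    using finite_S[OF assms(1)] by (intro sum_mono card_mono) auto
  also have "\<dots> = m" using sum_column_card[OF assms(1), of Second] by (simp add: snd_eq)
  finally have "(\<Sum>z=1..n. real (card {e \<in> S j. snd e = z \<and> P e})) \<le> m"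
    by (simp flip: of_nat_sum)
  also have "\<dots> \<le> B * q" by (rule m_le_B)
  also have "\<dots> \<le> (B * C) * q"
    using assms(2) B_pos by (intro mult_right_mono) auto
  finally show ?thesis .
qed

definition linked :: "(nat \<Rightarrow> nat \<Rightarrow> nat) \<Rightarrow> nat \<Rightarrow> nat \<Rightarrow> (nat \<times> nat) set" where
  "linked h j l = {e \<in> S 2. j \<in> targets st h 0 (fst e) \<and> l \<in> targets st h 1 (snd e)}"

definition joined :: "(nat \<Rightarrow> nat \<Rightarrow> nat) \<Rightarrow> nat \<Rightarrow> nat \<Rightarrow> nat \<Rightarrow> (nat \<times> nat) set" where
  "joined h i j l = {e \<in> S (2 * i). (\<exists>x. (x, fst e) \<in> grouped h (i - 1) j) \<and>
     l \<in> targets st h i (snd e)}"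

text \<open>This depends on hash function 0 only, and \<open>joined_weight\<close> on hash function
  \<open>i - 1\<close> only, so the hash function of the second column is still fresh.\<close>

definition linked_weight :: "nat \<Rightarrow> (nat \<Rightarrow> nat \<Rightarrow> nat) \<Rightarrow> nat \<Rightarrow> real" where
  "linked_weight j h z = card {e \<in> S 2. snd e = z \<and> j \<in> targets st h 0 (fst e)}"

definition joined_weight :: "nat \<Rightarrow> nat \<Rightarrow> (nat \<Rightarrow> nat \<Rightarrow> nat) \<Rightarrow> nat \<Rightarrow> real" where
  "joined_weight i j h z =
     card {e \<in> S (2 * i). snd e = z \<and> (\<exists>x. (x, fst e) \<in> grouped h (i - 1) j)}"

text \<open>Only these values need a probabilistic bound on \<open>linked_weight\<close>. There are
  at most \<open>q\<close> of them, which keeps \<open>n\<close> out of the union bound.\<close>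

definition dense :: "nat set" where
  "dense = {z \<in> {1..n}. card {e \<in> S 2. snd e = z} > B}"

lemma two_mem: "2 \<in> {1..k}"
  using k by simp

lemma card_dense_le: "card dense \<le> q"
proof -
  have snd_eq: "column_of Second e = snd e" for e by (cases e) simp
  have "B * card dense = (\<Sum>z\<in>dense. B)" by simp
  also have "\<dots> \<le> (\<Sum>z\<in>dense. real (card {e \<in> S 2. snd e = z}))"
    by (intro sum_mono) (auto simp: dense_def)
  also have "\<dots> \<le> (\<Sum>z=1..n. real (card {e \<in> S 2. snd e = z}))"
    by (intro sum_mono2) (auto simp: dense_def)
  also have "\<dots> = m"
    using sum_column_card[OF two_mem, of Second] by (simp add: snd_eq flip: of_nat_sum)
  also have "\<dots> \<le> B * q" by (rule m_le_B)
  finally show ?thesis using B_pos by simp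
qed

lemma card_linked:
  "real (card (linked h j l)) = (\<Sum>z=1..n. linked_weight j h z * indicator (targets st h 1 z) l)"
  using card_connecting_eq[OF two_mem, of "\<lambda>e. j \<in> targets st h 0 (fst e)" l "targets st h 1"]
  by (simp add: linked_def linked_weight_def)

lemma card_joined:
  assumes "2 * i \<in> {1..k}"
  shows "real (card (joined h i j l)) =
    (\<Sum>z=1..n. joined_weight i j h z * indicator (targets st h i z) l)"
  using card_connecting_eq[OF assms, of "\<lambda>e. \<exists>x. (x, fst e) \<in> grouped h (i - 1) j" l "targets st h i"]
  by (simp add: joined_def joined_weight_def)

text \<open>In this form the weight is itself a sum over arcs, now of hash function 0 and with 0/1
  weights.\<close>

lemma linked_weight_eq:
  "linked_weight j h z =
    (\<Sum>y=1..n. indicator (S 2) (y, z) * indicator (targets st h 0 y) j)"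
proof -
  have "{e \<in> S 2. snd e = z \<and> j \<in> targets st h 0 (fst e)} =
      (\<lambda>y. (y, z)) ` {y \<in> {1..n}. (y, z) \<in> S 2 \<and> j \<in> targets st h 0 y}"
    using S_subset[OF two_mem] by force
  then have "linked_weight j h z = card {y \<in> {1..n}. (y, z) \<in> S 2 \<and> j \<in> targets st h 0 y}"
    unfolding linked_weight_def by (simp add: card_image inj_on_def)
  also have "\<dots> = (\<Sum>y=1..n. indicator {y. (y, z) \<in> S 2 \<and> j \<in> targets st h 0 y} y)"
    by (simp add: indicator_def Int_def)
  also have "\<dots> = (\<Sum>y=1..n. indicator (S 2) (y, z) * indicator (targets st h 0 y) j)"
    by (intro sum.cong) (auto simp: indicator_def)
  finally show ?thesis .
qed

text \<open>Tuples with the same second entry differ in the first, and each first entry is witnessed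
  by its own tuple of the group.\<close>

lemma joined_weight_le:
  assumes "2 * i \<in> {1..k}"
  shows "joined_weight i j h z \<le> card (grouped h (i - 1) j)"
proof -
  let ?E = "{e \<in> S (2 * i). snd e = z \<and> (\<exists>x. (x, fst e) \<in> grouped h (i - 1) j)}"
  have "card ?E = card (fst ` ?E)"
    by (intro card_image[symmetric]) (auto simp: inj_on_def)
  also have "\<dots> \<le> card (snd ` grouped h (i - 1) j)"
    by (intro card_mono finite_imageI finite_grouped) force
  also have "\<dots> \<le> card (grouped h (i - 1) j)"
    by (intro card_image_le finite_grouped)
  finally show ?thesis by (simp add: joined_weight_def)
qed

section \<open>Bad events and the union bound\<close>

context
  fixes s :: real
  assumes s: "s \<ge> 1"
begin

definition bad_grouped :: "nat \<Rightarrow> nat \<Rightarrow> (nat \<Rightarrow> nat \<Rightarrow> nat) set" where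
  "bad_grouped i l = {h. (\<forall>z\<in>{1..n}. 0 \<le> share i z \<and> share i z \<le> B) \<and>
     (\<Sum>z=1..n. share i z * indicator (targets st h i z) l) > B * s}"

definition bad_dense :: "nat \<Rightarrow> nat \<Rightarrow> (nat \<Rightarrow> nat \<Rightarrow> nat) set" where
  "bad_dense z j = {h. (\<forall>y\<in>{1..n}. 0 \<le> indicat_real (S 2) (y, z) \<and> indicat_real (S 2) (y, z) \<le> B) \<and>
     (\<Sum>y=1..n. indicat_real (S 2) (y, z) * indicator (targets st h 0 y) j) > B * s}"

text \<open>Here, as in \<open>bad_joined\<close>, the weights are random and bounded only by
  \<open>B * s\<close>, so a second tail bound brings a second factor \<open>s\<close>.\<close>

definition bad_linked :: "nat \<Rightarrow> nat \<Rightarrow> (nat \<Rightarrow> nat \<Rightarrow> nat) set" where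
  "bad_linked j l = {h. (\<forall>z\<in>{1..n}. 0 \<le> linked_weight j h z \<and> linked_weight j h z \<le> B * s) \<and>
     (\<Sum>z=1..n. linked_weight j h z * indicator (targets st h 1 z) l) > B * s * s}"

definition bad_joined :: "nat \<Rightarrow> nat \<Rightarrow> nat \<Rightarrow> (nat \<Rightarrow> nat \<Rightarrow> nat) set" where
  "bad_joined i j l = {h. (\<forall>z\<in>{1..n}. 0 \<le> joined_weight i j h z \<and> joined_weight i j h z \<le> B * s) \<and>
     (\<Sum>z=1..n. joined_weight i j h z * indicator (targets st h i z) l) > B * s * s}"

definition bad :: "(nat \<Rightarrow> nat \<Rightarrow> nat) set" where
  "bad = (\<Union>(i, l)\<in>{..<d} \<times> {..<q}. bad_grouped i l) \<union>
     (\<Union>(z, j)\<in>dense \<times> {..<q}. bad_dense z j) \<union>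
     (\<Union>(j, l)\<in>{..<q} \<times> {..<q}. bad_linked j l) \<union>
     (\<Union>(i, j, l)\<in>{i. 2 \<le> i \<and> 2 * i < k} \<times> {..<q} \<times> {..<q}. bad_joined i j l)"

lemma B_ge_1: "B \<ge> 1"
proof -
  have "real p \<ge> 1" using q q_le_p by simp
  then show ?thesis using p_le_L by (simp add: B_def)
qed

lemma Bs_pos: "B * s > 0"
  using B_pos s by simp

lemma prob_bad_grouped: "i < d \<Longrightarrow> l < q \<Longrightarrow> measure_pmf.prob hashes (bad_grouped i l) \<le> exp (6 - s)"
  unfolding bad_grouped_def
  by (rule hashes_tail[where W = "\<lambda>h. share i"]) (use sum_share B_pos in auto)

lemma prob_bad_dense: "j < q \<Longrightarrow> measure_pmf.prob hashes (bad_dense z j) \<le> exp (6 - s)"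
  unfolding bad_dense_def
proof (rule hashes_tail[where W = "\<lambda>h y. indicator (S 2) (y, z)"])
  have "(\<Sum>y=1..n. indicator (S 2) (y, z)) = real (card {y \<in> {1..n}. (y, z) \<in> S 2})"
    by (simp add: indicator_def Int_def)
  also have "card {y \<in> {1..n}. (y, z) \<in> S 2} = card ((\<lambda>y. (y, z)) ` {y \<in> {1..n}. (y, z) \<in> S 2})"
    by (intro card_image[symmetric]) (auto simp: inj_on_def)
  also have "\<dots> \<le> card (S 2)"
    using finite_S[OF two_mem] by (intro card_mono) auto
  finally show "(\<Sum>y=1..n. indicator (S 2) (y, z)) \<le> B * real q"
    using m_le_B card_S[OF two_mem] by linarith
qed (use d B_pos in auto)

lemma prob_bad_linked:
  "j < q \<Longrightarrow> l < q \<Longrightarrow> measure_pmf.prob hashes (bad_linked j l) \<le> exp (6 - s)"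
  unfolding bad_linked_def
proof (rule hashes_tail[where W = "linked_weight j"])
  show "(\<Sum>z=1..n. linked_weight j h z) \<le> B * s * real q" for h
    unfolding linked_weight_def by (rule sum_connecting_le[OF two_mem s])
  show "linked_weight j (h(1 := x)) z = linked_weight j h z" for h x z
    by (simp add: linked_weight_def targets_def)
qed (use d k Bs_pos in \<open>auto simp: div_greater_zero_iff\<close>)

lemma grouped_upd: "i \<noteq> i' \<Longrightarrow> grouped (h(i := x)) i' l = grouped h i' l"
  by (simp add: grouped_def grp_def group_of_def)

lemma prob_bad_joined:
  assumes "2 \<le> i" "2 * i < k" "j < q" "l < q"
  shows "measure_pmf.prob hashes (bad_joined i j l) \<le> exp (6 - s)"
  unfolding bad_joined_def
proof (rule hashes_tail[where W = "joined_weight i j"])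
  show "(\<Sum>z=1..n. joined_weight i j h z) \<le> B * s * real q" for h
    unfolding joined_weight_def by (rule sum_connecting_le[OF _ s]) (use assms in auto)
  show "joined_weight i j (h(i := x)) z = joined_weight i j h z" for h x z
    using assms by (simp add: joined_weight_def grouped_upd)
qed (use d assms Bs_pos in auto)

text \<open>There are at most \<open>d * q\<close>, \<open>q ^ 2\<close>, \<open>q ^ 2\<close> and
  \<open>d * q ^ 2\<close> events of the four kinds, each of probability at most
  \<open>exp (6 - s)\<close>.\<close>

lemma prob_bad: "measure_pmf.prob hashes bad \<le> (2 * d + 2) * real q ^ 2 * exp (6 - s)"
proof -
  let ?\<epsilon> = "exp (6 - s)"
  let ?P = "measure_pmf.prob hashes"
  let ?I = "{i. 2 \<le> i \<and> 2 * i < k}"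
  let ?A1 = "\<Union>(i, l)\<in>{..<d} \<times> {..<q}. bad_grouped i l"
  let ?A2 = "\<Union>(z, j)\<in>dense \<times> {..<q}. bad_dense z j"
  let ?A3 = "\<Union>(j, l)\<in>{..<q} \<times> {..<q}. bad_linked j l"
  let ?A4 = "\<Union>(i, j, l)\<in>?I \<times> {..<q} \<times> {..<q}. bad_joined i j l"
  have I: "?I \<subseteq> {..<d}" using d by auto
  then have finI: "finite ?I" by (rule finite_subset) simp
  have cardI: "card ?I \<le> d" using card_mono[OF _ I] by simp
  have qq: "real q \<le> real q ^ 2" using q by (simp add: power2_eq_square)
  have "?P ?A1 \<le> card ({..<d} \<times> {..<q}) * ?\<epsilon>"
    by (rule prob_UN_le) (auto intro: prob_bad_grouped)
  also have "\<dots> \<le> d * real q ^ 2 * ?\<epsilon>"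
    using qq by (intro mult_right_mono) (auto intro: mult_left_mono)
  finally have 1: "?P ?A1 \<le> d * real q ^ 2 * ?\<epsilon>" .
  have "?P ?A2 \<le> card (dense \<times> {..<q}) * ?\<epsilon>"
    by (rule prob_UN_le) (auto intro: prob_bad_dense simp: dense_def)
  also have "\<dots> \<le> real q ^ 2 * ?\<epsilon>"
    using card_dense_le by (intro mult_right_mono) 
      (auto simp: power2_eq_square card_cartesian_product intro!: mult_right_mono)
  finally have 2: "?P ?A2 \<le> real q ^ 2 * ?\<epsilon>" .
  have "?P ?A3 \<le> card ({..<q} \<times> {..<q}) * ?\<epsilon>"
    by (rule prob_UN_le) (auto intro: prob_bad_linked)
  then have 3: "?P ?A3 \<le> real q ^ 2 * ?\<epsilon>" by (simp add: power2_eq_square)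
  have "?P ?A4 \<le> card (?I \<times> {..<q} \<times> {..<q}) * ?\<epsilon>"
    by (rule prob_UN_le) (use finI in \<open>auto intro: prob_bad_joined\<close>)
  also have "\<dots> \<le> d * real q ^ 2 * ?\<epsilon>"
    using cardI by (intro mult_right_mono)
      (auto simp: power2_eq_square card_cartesian_product intro!: mult_right_mono)
  finally have 4: "?P ?A4 \<le> d * real q ^ 2 * ?\<epsilon>" .
  have "?P bad \<le> ?P ?A1 + ?P ?A2 + ?P ?A3 + ?P ?A4"
    unfolding bad_def
    by (intro order_trans[OF measure_Un_le] add_right_mono) auto
  also have "\<dots> \<le> (2 * d + 2) * real q ^ 2 * ?\<epsilon>"
    using 1 2 3 4 by (simp add: algebra_simps)
  finally show ?thesis .
qed

context
  fixes h :: "nat \<Rightarrow> nat \<Rightarrow> nat"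
  assumes good: "h \<notin> bad"
begin

lemma good_grouped:
  assumes "i < d" "l < q"
  shows "card (grouped h i l) \<le> B * s"
proof -
  have "h \<notin> bad_grouped i l" using good assms unfolding bad_def by blast
  then show ?thesis
    using card_grouped_le[of h i l] share_nonneg share_le by (simp add: bad_grouped_def)
qed

text \<open>Outside \<open>dense\<close> the full frequency in \<open>S 2\<close> is already at most
  \<open>B\<close>; inside, the event \<open>bad_dense\<close> is avoided.\<close>

lemma good_linked_weight:
  assumes "j < q" "z \<in> {1..n}"
  shows "linked_weight j h z \<le> B * s"
proof (cases "z \<in> dense")
  case True
  then have "h \<notin> bad_dense z j" using good assms(1) unfolding bad_def by blast
  moreover have "indicat_real (S 2) (y, z) \<le> B" for y
    using B_ge_1 B_pos by (simp add: indicator_def)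
  ultimately show ?thesis by (auto simp: bad_dense_def linked_weight_eq)
next
  case False
  have "linked_weight j h z \<le> card {e \<in> S 2. snd e = z}"
    unfolding linked_weight_def using finite_S[OF two_mem] by (intro of_nat_mono card_mono) auto
  also have "\<dots> \<le> B" using False assms(2) by (auto simp: dense_def)
  also have "\<dots> \<le> B * s" using B_pos s by simp
  finally show ?thesis .
qed

lemma good_linked:
  assumes "j < q" "l < q"
  shows "card (linked h j l) \<le> B * s * s"
proof -
  have "h \<notin> bad_linked j l" using good assms unfolding bad_def by blast
  then show ?thesis
    using good_linked_weight[OF assms(1)] unfolding card_linked bad_linked_def
    by (auto simp: linked_weight_def)
qed

text \<open>The weights are bounded by a group size, so \<open>good_grouped\<close> supplies the
  range condition built into \<open>bad_joined\<close>.\<close>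

lemma good_joined:
  assumes "2 \<le> i" "2 * i < k" "j < q" "l < q"
  shows "card (joined h i j l) \<le> B * s * s"
proof -
  have i: "2 * i \<in> {1..k}" "i - 1 < d" using assms d by auto
  have "joined_weight i j h z \<le> B * s" for z
    using joined_weight_le[OF i(1), of j h z] good_grouped[OF i(2) assms(3)] by linarith
  moreover have "h \<notin> bad_joined i j l" using good assms unfolding bad_def by blast
  ultimately show ?thesis
    unfolding card_joined[OF i(1)] bad_joined_def by (auto simp: joined_weight_def)
qed

end

end

end

section \<open>The load of the algorithm\<close>

context large_line_input
begin

definition spread :: "nat \<Rightarrow> nat \<Rightarrow> (nat \<times> nat) set" where
  "spread i t = {e \<in> S (2 * i).
     \<forall>i'<d. i' \<noteq> i - 1 \<longrightarrow> coords t i' = coords (owner (2 * i) e mod q ^ d) i'}"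

lemma card_frag_le:
  assumes "s < p" "j \<in> {1..k}"
  shows "card (frag s j) \<le> k * (2 * (m / p))"
proof -
  have "card (frag s j) \<le> (\<Sum>j=1..k. card (frag s j))"
    using assms(2) by (intro member_le_sum) auto
  moreover have "int (\<Sum>j=1..k. card (frag s j)) \<le> int k * \<lceil>real m / real p\<rceil>"
    using part assms(1) unfolding evenly_partitioned_def by blast
  ultimately have "int (card (frag s j)) \<le> int k * \<lceil>real m / real p\<rceil>"
    by linarith
  then have "real (card (frag s j)) \<le> real k * real_of_int \<lceil>real m / real p\<rceil>"
    by (metis of_int_le_iff of_int_mult of_int_of_nat_eq)
  also have "\<dots> \<le> k * (m / p + 1)"
    by (intro mult_left_mono) linarith+
  also have "\<dots> \<le> k * (2 * (m / p))"
  proof -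
    have "p \<le> m" using m_ge q by (metis le_trans mult.right_neutral mult_le_mono2)
    moreover have "p \<ge> 1" using q q_le_p by simp
    ultimately have "real m / real p \<ge> 1" by simp
    then show ?thesis by (intro mult_left_mono) auto
  qed
  finally show ?thesis .
qed

lemma card_lines_le:
  assumes "i0 < d"
  shows "card {b \<in> {..<q ^ d}. \<forall>i'<d. i' \<noteq> i0 \<longrightarrow> coords t i' = coords b i'} \<le> q"
proof -
  let ?A = "{b \<in> {..<q ^ d}. \<forall>i'<d. i' \<noteq> i0 \<longrightarrow> coords t i' = coords b i'}"
  have "inj_on (\<lambda>b. coords b i0) ?A"
  proof (rule inj_onI)
    fix a b assume ab: "a \<in> ?A" "b \<in> ?A" "coords a i0 = coords b i0"
    have "coords a i = coords b i" if "i < d" for i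
      using ab that by (cases "i = i0") auto
    then show "a = b" using ab server_eqI by simp
  qed
  then have "card ?A = card ((\<lambda>b. coords b i0) ` ?A)" by (rule card_image[symmetric])
  also have "\<dots> \<le> card {..<q}"
    using coords_less assms by (intro card_mono) auto
  finally show ?thesis by simp
qed

text \<open>A line has at most \<open>q\<close> points, each standing for at most
  \<open>2 * p / q ^ d\<close> owners, and each owner holds at most \<open>2 * k * m / p\<close>
  tuples. With \<open>d >= 2\<close> the product is at most \<open>4 * k * m / q\<close>.\<close>

lemma card_spread_le:
  assumes "2 \<le> i" "2 * i < k"
  shows "card (spread i t) \<le> 2 * k * B"
proof -
  define N where "N = q ^ d"
  define b where "b = {b \<in> {..<N}. \<forall>i'<d. i' \<noteq> i - 1 \<longrightarrow> coords t i' = coords b i'}"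
  define A where "A = {s \<in> {..<p}. s mod N \<in> b}"
  have i: "2 * i \<in> {1..k}" "i - 1 < d" using assms d by auto
  have N: "N \<ge> 1" "N \<le> p" using q by (simp_all add: N_def)
  have d2: "d \<ge> 2" using k d by simp
  have b_le: "card b \<le> q" using card_lines_le[OF i(2)] by (simp add: b_def N_def)
  have "A = (\<Union>x\<in>b. {s. s < p \<and> s mod N = x})" by (auto simp: A_def)
  then have "card A \<le> (\<Sum>x\<in>b. card {s. s < p \<and> s mod N = x})"
    by (simp only:) (rule card_UN_le, simp add: b_def)
  also have "\<dots> \<le> (\<Sum>x\<in>b. p div N + 1)"
    using card_residue_class_le[OF N(1)] by (intro sum_mono) auto
  also have "\<dots> = card b * (p div N + 1)" by simp
  also have "\<dots> \<le> q * (p div N + 1)" using b_le by (rule mult_le_mono1)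
  finally have "real (card A) \<le> real (q * (p div N + 1))" by (rule of_nat_mono)
  also have "\<dots> \<le> q * (2 * (p / N))"
  proof -
    have "real (p div N) \<le> p / N" by (rule of_nat_div_le_of_nat)
    moreover have "1 \<le> real p / N" using N by simp
    ultimately show ?thesis unfolding of_nat_mult of_nat_add by (intro mult_left_mono) simp_all
  qed
  finally have card_A: "card A \<le> q * (2 * (p / N))" .
  have "spread i t \<subseteq> (\<Union>s\<in>A. frag s (2 * i))"
  proof
    fix e assume e: "e \<in> spread i t"
    then have "e \<in> S (2 * i)" by (simp add: spread_def)
    then have "owner (2 * i) e < p" "e \<in> frag (owner (2 * i) e) (2 * i)"
      using owner_less[OF i(1)] i(1) by (simp_all add: mem_frag_iff)
    moreover have "owner (2 * i) e mod N \<in> b"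
    proof -
      have "owner (2 * i) e mod N < N" using N(1) by simp
      then show ?thesis using e by (simp add: b_def spread_def N_def)
    qed
    ultimately show "e \<in> (\<Union>s\<in>A. frag s (2 * i))" by (auto simp: A_def)
  qed
  moreover have fin: "finite (frag s (2 * i))" for s
    using finite_S[OF i(1)] by (rule rev_finite_subset) (auto simp: mem_frag_iff)
  ultimately have "card (spread i t) \<le> card (\<Union>s\<in>A. frag s (2 * i))"
    by (intro card_mono) (auto simp: A_def)
  also have "\<dots> \<le> (\<Sum>s\<in>A. card (frag s (2 * i)))"
    by (rule card_UN_le) (simp add: A_def)
  finally have "real (card (spread i t)) \<le> (\<Sum>s\<in>A. real (card (frag s (2 * i))))"
    by (simp flip: of_nat_sum)
  also have "\<dots> \<le> card A * (k * (2 * (m / p)))"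
    using card_frag_le[OF _ i(1)] by (intro sum_bounded_above) (auto simp: A_def)
  also have "\<dots> \<le> q * (2 * (p / N)) * (k * (2 * (m / p)))"
    using card_A by (rule mult_right_mono) simp
  also have "\<dots> = 4 * k * m * (q / N)"
    using N by (simp add: field_simps)
  also have "\<dots> \<le> 4 * k * m * (1 / q)"
  proof (rule mult_left_mono)
    have "real q * real q \<le> N"
      using q d2 power_increasing[of 2 d q] by (simp add: N_def power2_eq_square flip: of_nat_mult)
    then show "real q / N \<le> 1 / q" using q N by (simp add: divide_simps)
  qed simp
  also have "\<dots> = 2 * k * B" by (simp add: B_def L_def)
  finally show ?thesis .
qed

lemma known1_cases:
  assumes "x \<in> known1 h t"
  shows "t < q ^ d \<and> (x \<in> (\<Union>i<d. {rel_of i} \<times> grouped h i (coords t i)) \<or>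
    x \<in> {2} \<times> linked h (coords t 0) (coords t 1) \<or>
    x \<in> (\<Union>i\<in>{i. 2 \<le> i \<and> 2 * i < k}. {2 * i} \<times> spread i t))"
proof -
  obtain j e where x: "x = (j, e)" by (cases x)
  with assms obtain s where "(j, e) \<in> message1 st h (frag s) s t"
    by (auto simp: known1_def sent1_def)
  then show ?thesis
  proof (cases rule: message1_cases)
    case (coordinate i)
    then have "e \<in> grouped h i (coords t i)"
      by (simp add: grouped_def grp_def mem_frag_iff)
    then show ?thesis using coordinate(1-3) x by blast
  next
    case second
    then have "e \<in> linked h (coords t 0) (coords t 1)"
      by (simp add: linked_def mem_frag_iff)
    then show ?thesis using second(1,2) x by blast
  next
    case (connecting i)
    then have "e \<in> spread i t" by (simp add: spread_def mem_frag_iff)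
    then show ?thesis using connecting(1-4) x by blast
  qed
qed

text \<open>The sender shares coordinate \<open>i - 1\<close> with \<open>t\<close>, so the semijoin
  partner it found belongs to the group of \<open>t\<close>.\<close>

lemma known2_cases:
  assumes "x \<in> known2 h t"
  shows "t < q ^ d \<and>
    x \<in> (\<Union>i\<in>{i. 2 \<le> i \<and> 2 * i < k}. {2 * i} \<times> joined h i (coords t (i - 1)) (coords t i))"
proof -
  from assms obtain s where "x \<in> sent2 h s t" by (auto simp: known2_def)
  then obtain i e x' where i: "x = (2 * i, e)" "s < q ^ d" "t < q ^ d" "2 \<le> i" "2 * i < k"
      "(2 * i, e) \<in> known1 h s" "(rel_of (i - 1), x', fst e) \<in> known1 h s"
      "coords t (i - 1) = coords s (i - 1)" "coords t i \<in> targets st h i (snd e)"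
    unfolding sent2_def message2_def by (auto split: if_splits)
  have "2 * (i - 1) + 1 \<le> k" using i by simp
  then have "(x', fst e) \<in> grouped h (i - 1) (coords t (i - 1))"
    using known1_grouped[OF i(7)] i(8) by (simp add: grouped_def)
  moreover have "e \<in> S (2 * i)"
    using known1_connecting_iff[OF i(4,5)] i(6) by blast
  ultimately have "e \<in> joined h i (coords t (i - 1)) (coords t i)"
    using i(9) by (auto simp: joined_def)
  then show ?thesis using i by blast
qed

lemma finite_dims: "finite {i. 2 \<le> i \<and> 2 * i < k}"
  and card_dims: "card {i. 2 \<le> i \<and> 2 * i < k} \<le> d"
proof -
  have sub: "{i. 2 \<le> i \<and> 2 * i < k} \<subseteq> {..<d}" using d by auto
  then show "finite {i. 2 \<le> i \<and> 2 * i < k}" by (rule finite_subset) simp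
  show "card {i. 2 \<le> i \<and> 2 * i < k} \<le> d" using card_mono[OF _ sub] by simp
qed

lemma finite_linked: "finite (linked h j l)"
  using finite_S[OF two_mem] by (simp add: linked_def)

lemma finite_spread: "2 * i < k \<Longrightarrow> 2 \<le> i \<Longrightarrow> finite (spread i t)"
  using finite_S[of "2 * i"] by (simp add: spread_def)

lemma finite_joined: "2 * i < k \<Longrightarrow> 2 \<le> i \<Longrightarrow> finite (joined h i j l)"
  using finite_S[of "2 * i"] by (simp add: joined_def)

text \<open>The terms stand for \<open>d\<close> groups, the linked part of \<open>S 2\<close>, and
  the spread relations. The joined parts of the second round number at most \<open>d\<close> and fit
  as well.\<close>

definition load_bound :: "real \<Rightarrow> real" where
  "load_bound s = (d + 1 + 2 * k * d) * B * s * s"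

lemma card_known_le:
  assumes s: "s \<ge> 1" and good: "h \<notin> bad s"
  shows "card (known1 h t) \<le> load_bound s"
    and "card (known2 h t) \<le> load_bound s"
proof -
  let ?I = "{i. 2 \<le> i \<and> 2 * i < k}"
  have ss: "B \<le> B * s * s" "B * s \<le> B * s * s"
    using s B_pos mult_left_mono[of 1 s "B * s"] mult_left_mono[of 1 "s * s" B] mult_mono[of 1 s 1 s]
    by (auto simp: mult.assoc)
  have Bss: "B * s * s \<ge> 0" using ss B_pos by linarith
  have *: "card (known1 h t) \<le> load_bound s \<and> card (known2 h t) \<le> load_bound s"
  proof (cases "t < q ^ d")
    case False
    then have "known1 h t = {}" "known2 h t = {}"
      using known1_cases[of _ h t] known2_cases[of _ h t] by blast+
    then show ?thesis using Bss by (simp add: load_bound_def mult.assoc)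
  next
    case True
    have c: "coords t i < q" if "i < d" for i using coords_less[OF True that] .
    have d2: "0 < d" "1 < d" using d k by auto
    let ?A1 = "\<Union>i\<in>{..<d}. {rel_of i} \<times> grouped h i (coords t i)"
    let ?A2 = "{2::nat} \<times> linked h (coords t 0) (coords t 1)"
    let ?A3 = "\<Union>i\<in>?I. {2 * i} \<times> spread i t"
    let ?A4 = "\<Union>i\<in>?I. {2 * i} \<times> joined h i (coords t (i - 1)) (coords t i)"
    have "card ?A1 \<le> card {..<d} * (B * s)"
      using good_grouped[OF s good] c by (intro card_tagged_UN_le) auto
    also have "\<dots> \<le> d * (B * s * s)" using ss by (simp add: mult_left_mono)
    finally have 1: "card ?A1 \<le> d * (B * s * s)" .
    have 2: "card ?A2 \<le> B * s * s"
      using good_linked[OF s good] c d2 by (simp add: card_cartesian_product)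
    have "card ?A3 \<le> card ?I * (2 * k * B)"
      using card_spread_le finite_dims by (intro card_tagged_UN_le) auto
    also have "\<dots> \<le> d * (2 * k * (B * s * s))"
      using card_dims ss B_pos by (intro mult_mono) auto
    finally have 3: "card ?A3 \<le> 2 * k * d * (B * s * s)" by (simp add: mult_ac)
    have "card ?A4 \<le> card ?I * (B * s * s)"
    proof (rule card_tagged_UN_le[OF finite_dims])
      fix i assume i: "i \<in> ?I"
      then have "i - 1 < d" "i < d" using d by auto
      then show "card (joined h i (coords t (i - 1)) (coords t i)) \<le> B * s * s"
        using good_joined[OF s good, of i] i c by simp
    qed
    also have "\<dots> \<le> d * (B * s * s)" using card_dims Bss by (intro mult_right_mono) auto
    finally have 4: "card ?A4 \<le> d * (B * s * s)" .
    have bound: "load_bound s = d * (B * s * s) + B * s * s + 2 * k * d * (B * s * s)"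
      by (simp add: load_bound_def algebra_simps)
    have fin: "finite ?A1" "finite ?A2" "finite ?A3" "finite ?A4"
      using finite_dims by (auto intro!: finite_grouped finite_linked finite_spread finite_joined)
    have "known1 h t \<subseteq> ?A1 \<union> ?A2 \<union> ?A3" using known1_cases[of _ h t] by blast
    then have "card (known1 h t) \<le> card (?A1 \<union> ?A2 \<union> ?A3)"
      using fin by (intro card_mono) auto
    also have "\<dots> \<le> card ?A1 + card ?A2 + card ?A3"
      by (meson add_right_mono card_Un_le le_trans)
    finally have "card (known1 h t) \<le> load_bound s"
      using 1 2 3 unfolding bound by linarith
    moreover have "card (known2 h t) \<le> load_bound s"
    proof -
      have "known2 h t \<subseteq> ?A4" using known2_cases[of _ h t] by blast
      then have "card (known2 h t) \<le> card ?A4" using fin by (intro card_mono) auto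
      moreover have "2 * k * d * (B * s * s) \<ge> 0" using Bss by simp
      ultimately show ?thesis using 4 Bss unfolding bound by linarith
    qed
    ultimately show ?thesis by blast
  qed
  show "card (known1 h t) \<le> load_bound s" "card (known2 h t) \<le> load_bound s"
    using * by blast+
qed

lemma load_bound_nonneg: "s \<ge> 1 \<Longrightarrow> load_bound s \<ge> 0"
  using B_pos by (simp add: load_bound_def)

lemma hash_of_seed_encoded: "h \<in> set_pmf hashes \<Longrightarrow> hash_of_seed (to_nat_on (set_pmf hashes) h) = h"
  by (simp add: hash_of_seed_def)

lemma algorithm_correct:
  assumes "\<omega> \<in> set_pmf (seed_distribution algorithm)"
  shows "mpc_output algorithm p (initial_view p k S owner \<omega>) = line_query k S"
proof -
  obtain h where "h \<in> set_pmf hashes" "\<omega> = to_nat_on (set_pmf hashes) h"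
    using assms by (auto simp: algorithm_def)
  then have "hash_of_seed \<omega> = h" by (simp add: hash_of_seed_encoded)
  then show ?thesis by (rule output_correct)
qed

lemma algorithm_load:
  assumes s: "s \<ge> 1"
  shows "measure_pmf.prob (seed_distribution algorithm)
      {\<omega>. real (mpc_load algorithm p (initial_view p k S owner \<omega>)) \<le> w * load_bound s}
    \<ge> 1 - (2 * d + 2) * real q ^ 2 * exp (6 - s)"
proof -
  let ?enc = "to_nat_on (set_pmf hashes)"
  let ?G = "{h. real (mpc_load algorithm p (initial_view p k S owner (?enc h))) \<le> w * load_bound s}"
  have "set_pmf hashes - bad s \<subseteq> ?G"
  proof safe
    fix h assume h: "h \<in> set_pmf hashes" "h \<notin> bad s"
    have "card (known1 h t) \<le> nat \<lfloor>load_bound s\<rfloor>" "card (known2 h t) \<le> nat \<lfloor>load_bound s\<rfloor>" for t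
      using card_known_le[OF s h(2), of t] by (simp_all add: le_nat_floor)
    then have "mpc_load algorithm p (initial_view p k S owner (?enc h)) \<le> w * nat \<lfloor>load_bound s\<rfloor>"
      using mpc_load_le[OF hash_of_seed_encoded[OF h(1)]] by blast
    then have "real (mpc_load algorithm p (initial_view p k S owner (?enc h))) \<le>
        real (w * nat \<lfloor>load_bound s\<rfloor>)" by (rule of_nat_mono)
    also have "\<dots> \<le> w * load_bound s"
      unfolding of_nat_mult using load_bound_nonneg[OF s] by (intro mult_left_mono) auto
    finally show "real (mpc_load algorithm p (initial_view p k S owner (?enc h))) \<le> w * load_bound s" .
  qed
  \<comment> \<open>Seeds decode correctly only on the support; intersecting with it costs no
    probability.\<close>
  then have "(UNIV - bad s) \<inter> set_pmf hashes \<subseteq> ?G" by blast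
  then have "measure_pmf.prob hashes ((UNIV - bad s) \<inter> set_pmf hashes) \<le> measure_pmf.prob hashes ?G"
    by (intro measure_pmf.finite_measure_mono) auto
  moreover have "measure_pmf.prob hashes ((UNIV - bad s) \<inter> set_pmf hashes) =
      1 - measure_pmf.prob hashes (bad s)"
    using measure_pmf.prob_compl[of "bad s" hashes] by (simp add: measure_Int_set_pmf)
  ultimately show ?thesis
    using prob_bad[OF s] by (simp add: algorithm_def vimage_def)
qed

end

section \<open>The trivial algorithm for one server\<close>

definition single_server_algorithm :: "nat \<Rightarrow> mpc_algorithm" where
  "single_server_algorithm k = \<lparr> rounds = 0, seed_distribution = return_pmf 0,
     send = (\<lambda>_ _ _. []), answers = (\<lambda>_ v. line_query k (local_input v)) \<rparr>"

lemma single_server_output: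
  assumes "evenly_partitioned 1 k m S owner"
  shows "mpc_output (single_server_algorithm k) 1 (initial_view 1 k S owner \<omega>) = line_query k S"
proof -
  have "fragment k S owner 0 j = S j" if "j \<in> {1..k}" for j
    using assms that by (auto simp: evenly_partitioned_def fragment_def)
  then show ?thesis
    by (auto simp: mpc_output_def single_server_algorithm_def initial_view_def line_query_def)
qed

lemma single_server_load: "mpc_load (single_server_algorithm k) p V = 0"
  by (simp add: mpc_load_def single_server_algorithm_def)

section \<open>Grid side, tuple width and overhead factor\<close>

lemma integer_root_exists:
  fixes p d :: nat
  assumes "p \<ge> 1" "d \<ge> 1"
  obtains q :: nat where "q \<ge> 1" "q ^ d \<le> p" "real p powr (1 / real d) \<le> 2 * real q"
proof -
  define x where "x = real p powr (1 / real d)"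
  have x: "x \<ge> 1" using assms by (simp add: x_def ge_one_powr_ge_zero)
  have xd: "x ^ d = p"
    using assms by (simp add: x_def powr_power)
  \<comment> \<open>Rounding down a number that is at least 1 loses less than a factor 2.\<close>
  define q where "q = nat \<lfloor>x\<rfloor>"
  have q: "real q \<le> x" "x < real q + 1" "q \<ge> 1"
    using x by (auto simp: q_def le_nat_floor)
  have "real (q ^ d) \<le> real p"
    using q(1) by (simp add: power_mono flip: xd)
  then have "q ^ d \<le> p" by (simp only: of_nat_le_iff)
  then show ?thesis using q by (intro that[of q]) (auto simp flip: x_def)
qed

lemma coords_exists:
  "\<exists>coords. bij_betw coords {..<q ^ d} ({..<d} \<rightarrow>\<^sub>E {..<q::nat})"
proof -
  have "card ({..<d} \<rightarrow>\<^sub>E {..<q}) = q ^ d" by (simp add: card_PiE)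
  then show ?thesis
    using ex_bij_betw_nat_finite[of "{..<d} \<rightarrow>\<^sub>E {..<q}"]
    by (simp add: finite_PiE atLeast0LessThan)
qed

text \<open>\<open>k\<close> bits hold the relation index and \<open>b\<close> bits each value.
  Since \<open>log 2 n >= 1\<close>, the additive constants are absorbed into the logarithm.\<close>

lemma tuple_width_exists:
  fixes n k :: nat
  assumes "n \<ge> 2" "k \<ge> 2"
  obtains w :: nat where "w > 0" "k * (n * n) \<le> 2 ^ w" "real w \<le> (k + 4) * log 2 n"
proof -
  define b where "b = nat \<lceil>log 2 n\<rceil>"
  have l: "log 2 n \<ge> 1" using assms by simp
  have b: "log 2 n \<le> real b" "real b \<le> log 2 n + 1"
    using l by (auto simp: b_def)
  have "real n = 2 powr (log 2 n)" using assms by simp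
  also have "\<dots> \<le> 2 powr (real b)" using b by (intro powr_mono) auto
  also have "\<dots> = real (2 ^ b)" by (simp add: powr_realpow)
  finally have "n \<le> 2 ^ b" by (simp only: of_nat_le_iff)
  moreover have "k \<le> 2 ^ k" by (simp add: less_imp_le)
  ultimately have "k * (n * n) \<le> 2 ^ k * (2 ^ b * 2 ^ b)" by (intro mult_le_mono)
  also have "\<dots> = 2 ^ (k + 2 * b)" by (simp add: power_add mult_2)
  finally have "k * (n * n) \<le> 2 ^ (k + 2 * b)" .
  moreover have "real (k + 2 * b) \<le> (k + 4) * log 2 n"
  proof -
    have "real k * 1 \<le> real k * log 2 n" using l by (intro mult_left_mono) auto
    then show ?thesis using b l by (simp add: algebra_simps)
  qed
  ultimately show ?thesis using assms by (intro that[of "k + 2 * b"]) auto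
qed

text \<open>\<open>k + 4\<close> is the tuple width, the long sum comes from
  \<open>load_bound\<close>, and the square is its \<open>s * s\<close>. The leading 2 remains from
  the 4 in the bound on \<open>B\<close> after \<open>size_in_bits\<close> takes a factor 2.\<close>

definition overhead :: "nat \<Rightarrow> nat \<Rightarrow> real" where
  "overhead k p =
     real (2 * (k + 4) * (k div 2 + 1 + 1 + 2 * k * (k div 2 + 1))) * (6 + 2 * ln (real p))\<^sup>2"

lemma polylog_overhead: "polylog (overhead k)"
proof -
  have "(\<lambda>p::nat. C * (6 + 2 * ln (real p))\<^sup>2) \<in> O(\<lambda>p. ln (real p) ^ 2)" for C :: real
  proof -
    have "(\<lambda>p::nat. 6 + 2 * ln (real p)) \<in> O(\<lambda>p. ln (real p))"
    proof (rule landau_o.bigI[of 8])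
      have "norm (6 + 2 * ln (real p)) \<le> 8 * norm (ln (real p))" if "p \<ge> 3" for p :: nat
      proof -
        have "exp 1 \<le> real p" using exp_le that by linarith
        then have "ln (real p) \<ge> 1" using that by (subst ln_ge_iff) auto
        then show ?thesis by simp
      qed
      then show "\<forall>\<^sub>F p::nat in sequentially. norm (6 + 2 * ln (real p)) \<le> 8 * norm (ln (real p))"
        by (rule eventually_sequentiallyI)
    qed simp
    then have "(\<lambda>p::nat. (6 + 2 * ln (real p))\<^sup>2) \<in> O(\<lambda>p. ln (real p) ^ 2)"
      by (rule landau_o.big_power)
    then show ?thesis by simp
  qed
  then show ?thesis unfolding polylog_def overhead_def by blast
qed

section \<open>Choice of parameters for at least two servers\<close>

lemma many_servers:
  fixes k n m p :: nat
  assumes k2: "k \<ge> 2" and p2: "p \<ge> 2" and mp: "m \<ge> p ^ 2" and n2: "n \<ge> 2"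
  shows "\<exists>A :: mpc_algorithm. rounds A \<le> k div 2 \<and>
    (\<forall>S owner. line_instance k n m S \<and> evenly_partitioned p k m S owner \<longrightarrow>
      (\<forall>\<omega>\<in>set_pmf (seed_distribution A).
        mpc_output A p (initial_view p k S owner \<omega>) = line_query k S) \<and>
      measure_pmf.prob (seed_distribution A)
        {\<omega>. real (mpc_load A p (initial_view p k S owner \<omega>))
          \<le> overhead k p * (size_in_bits n m / real p powr (1 / real (k div 2 + 1)))}
        \<ge> 1 - real (2 * (k div 2 + 1) + 2) / real p)"
proof -
  define d where "d = k div 2 + 1"
  have d2: "d \<ge> 2" using k2 by (simp add: d_def)
  obtain q :: nat where qr: "q \<ge> 1" "q ^ d \<le> p" "real p powr (1 / real d) \<le> 2 * real q"
    using integer_root_exists[of p d] p2 d2 by auto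
  obtain coords where co: "bij_betw coords {..<q ^ d} ({..<d} \<rightarrow>\<^sub>E {..<q})"
    using coords_exists by blast
  obtain w :: nat where w: "w > 0" "k * (n * n) \<le> 2 ^ w" "real w \<le> (k + 4) * log 2 n"
    using tuple_width_exists[OF n2 k2] by blast
  obtain enc :: "items \<Rightarrow> bool list"
    where en: "inj_on enc (Pow ({1..k} \<times> {1..n} \<times> {1..n}))"
      "\<And>X. X \<subseteq> {1..k} \<times> {1..n} \<times> {1..n} \<Longrightarrow> length (enc X) = w * card X"
    using set_encoding_exists[of "{1..k} \<times> {1..n} \<times> {1..n}" w] w
    by (auto simp: card_cartesian_product)
  have "1 \<le> p ^ 2" using p2 by simp
  then have m1: "m \<ge> 1" using mp by linarith
  interpret line_grid k n m p q d w coords enc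
    by (rule line_grid.intro[OF k2 d_def qr(1,2) m1 co en])
  have pq: "p * q \<le> m" using mult_le_mono2[OF q_le_p, of p] mp unfolding power2_eq_square by linarith
  have qq: "real q ^ 2 \<le> p"
  proof -
    have "q ^ 2 \<le> q ^ d" using qr d2 by (intro power_increasing) auto
    then have "real (q ^ 2) \<le> real p" using qr(2) by linarith
    then show ?thesis by simp
  qed
  \<comment> \<open>This makes \<open>exp (6 - s)\<close> equal to \<open>1 / p ^ 2\<close>, so with
    \<open>q ^ 2 <= p\<close> the failure probability is \<open>O(1 / p)\<close>.\<close>
  define s where "s = 6 + 2 * ln (real p)"
  have s: "s \<ge> 1" using p2 by (simp add: s_def)
  have "rounds algorithm \<le> k div 2" using k2 by (auto simp: algorithm_def)
  moreover have "(\<forall>\<omega>\<in>set_pmf (seed_distribution algorithm).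
        mpc_output algorithm p (initial_view p k S owner \<omega>) = line_query k S) \<and>
      measure_pmf.prob (seed_distribution algorithm)
        {\<omega>. real (mpc_load algorithm p (initial_view p k S owner \<omega>))
          \<le> overhead k p * (size_in_bits n m / real p powr (1 / real d))}
        \<ge> 1 - real (2 * d + 2) / real p"
    if "line_instance k n m S" "evenly_partitioned p k m S owner" for S owner
  proof -
    interpret large_line_input k n m p q d w coords enc S owner
      by unfold_locales (rule that pq)+
    have "B \<le> 4 * (m / real p powr (1 / real d))"
    proof -
      have "real m / real q \<le> m / (real p powr (1 / real d) / 2)"
        using qr p2 by (intro divide_left_mono) auto
      then show ?thesis by (simp add: B_def L_def)
    qed
    then have "real w * load_bound s \<le> ((k + 4) * log 2 n) *
        ((d + 1 + 2 * k * d) * (4 * (m / real p powr (1 / real d))) * s * s)"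
      unfolding load_bound_def using w(3) B_pos s n2
      by (intro mult_mono mult_nonneg_nonneg) auto
    also have "\<dots> = overhead k p * (size_in_bits n m / real p powr (1 / real d))"
    proof -
      have "overhead k p = 2 * real (k + 4) * real (d + 1 + 2 * k * d) * (s * s)"
        unfolding overhead_def s_def d_def power2_eq_square of_nat_mult by simp
      then show ?thesis by (simp add: size_in_bits_def algebra_simps add_divide_distrib)
    qed
    finally have load: "real w * load_bound s \<le>
        overhead k p * (size_in_bits n m / real p powr (1 / real d))" .
    have "exp (6 - s) = 1 / real p ^ 2"
      using p2 by (simp add: s_def exp_minus exp_double inverse_eq_divide flip: mult_2)
    then have "(2 * d + 2) * real q ^ 2 * exp (6 - s) = (2 * d + 2) * (real q ^ 2 / real p ^ 2)"
      by simp
    also have "\<dots> \<le> (2 * d + 2) * (1 / p)"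
      using qq p2 by (intro mult_left_mono) (auto simp: power2_eq_square divide_simps)
    finally have "1 - real (2 * d + 2) / real p \<le> 1 - (2 * d + 2) * real q ^ 2 * exp (6 - s)" by simp
    also have "\<dots> \<le> measure_pmf.prob (seed_distribution algorithm)
        {\<omega>. real (mpc_load algorithm p (initial_view p k S owner \<omega>)) \<le> w * load_bound s}"
      by (rule algorithm_load[OF s])
    also have "\<dots> \<le> measure_pmf.prob (seed_distribution algorithm)
        {\<omega>. real (mpc_load algorithm p (initial_view p k S owner \<omega>))
          \<le> overhead k p * (size_in_bits n m / real p powr (1 / real d))}"
      using load by (intro measure_pmf.finite_measure_mono) auto
    finally show ?thesis using algorithm_correct by blast
  qed
  ultimately show ?thesis unfolding d_def by blast
qed

theorem lemma4p5:
  fixes k :: nat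
  assumes "k \<ge> 2"
  shows "\<exists>(c::nat) (f::nat \<Rightarrow> real) (\<delta>::nat \<Rightarrow> real).
    polylog f \<and> \<delta> \<longlonglongrightarrow> 0 \<and>
    (\<forall>p n m :: nat. p \<ge> 1 \<and> m \<ge> p ^ c \<longrightarrow>
      (\<exists>A :: mpc_algorithm.
        int (rounds A) \<le> \<lfloor>real k / 2\<rfloor> \<and>
        (\<forall>S owner. line_instance k n m S \<and> evenly_partitioned p k m S owner \<longrightarrow>
          (\<forall>\<omega>\<in>set_pmf (seed_distribution A).
            mpc_output A p (initial_view p k S owner \<omega>) = line_query k S) \<and>
          measure_pmf.prob (seed_distribution A)
            {\<omega>. real (mpc_load A p (initial_view p k S owner \<omega>))
                 \<le> f p * (size_in_bits n m / real p powr (1 / real_of_int \<lceil>(real k + 1) / 2\<rceil>))}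
            \<ge> 1 - \<delta> p)))"
proof -
  have floor_k: "\<lfloor>real k / 2\<rfloor> = int (k div 2)"
    using floor_divide_of_nat_eq[of k 2] by simp
  have ceil_k: "real_of_int \<lceil>(real k + 1) / 2\<rceil> = real (k div 2 + 1)"
  proof -
    have "\<lceil>(real k + 1) / 2\<rceil> = int (k div 2 + 1)"
    proof (rule ceiling_unique)
      have "real k = 2 * real (k div 2) + real (k mod 2)"
        by (metis mult_div_mod_eq of_nat_add of_nat_mult of_nat_numeral)
      moreover have "real (k mod 2) \<le> 1" "real (k mod 2) \<ge> 0" by auto
      ultimately show "real_of_int (int (k div 2 + 1)) - 1 < (real k + 1) / 2"
        "(real k + 1) / 2 \<le> real_of_int (int (k div 2 + 1))" by (auto simp: field_simps)
    qed
    then show ?thesis by simp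
  qed
  define \<delta> where "\<delta> p = real (2 * (k div 2 + 1) + 2) / real p" for p
  have "\<delta> \<longlonglongrightarrow> 0" unfolding \<delta>_def by (rule lim_const_over_n)
  moreover have "\<exists>A :: mpc_algorithm. int (rounds A) \<le> \<lfloor>real k / 2\<rfloor> \<and>
      (\<forall>S owner. line_instance k n m S \<and> evenly_partitioned p k m S owner \<longrightarrow>
        (\<forall>\<omega>\<in>set_pmf (seed_distribution A).
          mpc_output A p (initial_view p k S owner \<omega>) = line_query k S) \<and>
        measure_pmf.prob (seed_distribution A)
          {\<omega>. real (mpc_load A p (initial_view p k S owner \<omega>))
            \<le> overhead k p *
              (size_in_bits n m / real p powr (1 / real_of_int \<lceil>(real k + 1) / 2\<rceil>))}
          \<ge> 1 - \<delta> p)"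
    if pm: "p \<ge> 1" "m \<ge> p ^ 2" for p n m :: nat
  proof -
    consider "p = 1" | "p \<ge> 2" "n \<ge> 2" | "p \<ge> 2" "n \<le> 1" using pm(1) by linarith
    then show ?thesis
    proof cases
      case 1
      \<comment> \<open>The case \<open>n = 0\<close> rests on the convention that
        \<open>ln 0\<close> is 0.\<close>
      have "log 2 (real n) \<ge> 0" by (cases "n = 0") (auto simp: log_def)
      then have "overhead k 1 * size_in_bits n m \<ge> 0"
        by (simp add: overhead_def size_in_bits_def)
      then show ?thesis
        using single_server_output single_server_load 1 \<delta>_def
        by (intro exI[of _ "single_server_algorithm k"])
           (auto simp: single_server_algorithm_def[of k, THEN arg_cong[of _ _ rounds]] \<delta>_def)
    next
      case 2
      show ?thesis
        using many_servers[OF assms 2(1) pm(2) 2(2)] unfolding ceil_k floor_k of_nat_le_iff \<delta>_def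
        by blast
    next
      case 3
      \<comment> \<open>A domain with at most one value admits at most one tuple, while
        \<open>m >= p ^ 2 >= 4\<close>; without instances any algorithm will do.\<close>
      have "\<not> line_instance k n m S" for S
      proof
        assume "line_instance k n m S"
        then have "S 1 \<subseteq> {1..n} \<times> {1..n}" "card (S 1) = m"
          using assms by (auto simp: line_instance_def)
        then have "m \<le> n * n"
          using card_mono[of "{1..n} \<times> {1..n}" "S 1"] by (simp add: card_cartesian_product)
        also have "\<dots> \<le> 1 * 1" using 3 by (intro mult_le_mono) auto
        finally show False using pm(2) 3(1) power_mono[of 2 p 2] by simp
      qed
      then show ?thesis
        by (intro exI[of _ "single_server_algorithm k"]) (simp add: single_server_algorithm_def)
    qed
  qed
  \<comment> \<open>The witnesses are \<open>c = 2\<close>, \<open>f = overhead k\<close> and the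
    \<open>\<delta>\<close> above.\<close>
  ultimately show ?thesis using polylog_overhead by blast
qed

end
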